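(* Let $A$ be a unital $C^*$-algebra and let $\alpha:A\to A$ be an injective unital $*$-endomorphism. If $(\pi,T)$ is a contractive covariant representation of $(A,\alpha)$ on a Hilbert space $H$, then there exists a covariant representation $(\sigma,U)$ of $(A,\alpha)$ on a Hilbert space $K$ containing $H$ (as a closed subspace) such that $U$ is unitary and such that $T^n=PU^n|_H$ for all $n\ge 0$, where $P$ denotes the orthogonal projection of $K$ onto $H$.
   Context: A representation of $A$ on a Hilbert space $H$ means a unital $*$-homomorphism $A\to B(H)$. A (contractive) covariant representation of $(A,\alpha)$ on a Hilbert space $H$ is a pair $(\pi,T)$ consisting of a representation $\pi:A\to B(H)$ and a contraction $T\in B(H)$ ($\|T\|\le 1$) such that $T\pi(\alpha(a))=\pi(a)T$ for all $a\in A$. *)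

theory Defs
  imports "HOL-Analysis.Analysis" "HOL-Library.Function_Algebras"
begin

section \<open>Unital C*-algebras\<close>

text \<open>The class \<^class>\<open>monoid_mult\<close> supplies the unit without the axiom
  \<open>0 \<noteq> 1\<close> of \<^class>\<open>ring_1\<close>, so the zero algebra is not excluded.\<close>

class unital_cstar_algebra = real_normed_algebra + banach + monoid_mult +
  fixes scaleC :: "complex \<Rightarrow> 'a \<Rightarrow> 'a"
    and star :: "'a \<Rightarrow> 'a"
  assumes scaleC_add_right: "scaleC c (a + b) = scaleC c a + scaleC c b"
    and scaleC_add_left: "scaleC (c + d) a = scaleC c a + scaleC d a"
    and scaleC_scaleC: "scaleC c (scaleC d a) = scaleC (c * d) a"
    and scaleR_scaleC: "scaleR r a = scaleC (complex_of_real r) a"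
    and mult_scaleC_left: "scaleC c a * b = scaleC c (a * b)"
    and mult_scaleC_right: "a * scaleC c b = scaleC c (a * b)"
    and norm_scaleC: "norm (scaleC c a) = cmod c * norm a"
    and star_star: "star (star a) = a"
    and star_add: "star (a + b) = star a + star b"
    and star_scaleC: "star (scaleC c a) = scaleC (cnj c) (star a)"
    and star_mult: "star (a * b) = star b * star a"
    and cstar_identity: "norm (star a * a) = (norm a)\<^sup>2"

definition unital_star_endomorphism :: "('a::unital_cstar_algebra \<Rightarrow> 'a) \<Rightarrow> bool" where
  "unital_star_endomorphism \<alpha> \<longleftrightarrow>
     (\<forall>a b. \<alpha> (a + b) = \<alpha> a + \<alpha> b) \<and>
     (\<forall>c a. \<alpha> (scaleC c a) = scaleC c (\<alpha> a)) \<and>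
     (\<forall>a b. \<alpha> (a * b) = \<alpha> a * \<alpha> b) \<and>
     (\<forall>a. \<alpha> (star a) = star (\<alpha> a)) \<and>
     \<alpha> 1 = 1"

section \<open>Complex Hilbert spaces\<close>

text \<open>The space is a linear subspace \<open>hcarrier\<close> of an ambient complex vector space,
  with an inner product that only matters on that subspace.  Keeping the carrier apart from
  the type makes it possible to assert the existence of a Hilbert space inside a formula.\<close>

record 'h hilbert_data =
  hcarrier :: "'h set"
  hscale :: "complex \<Rightarrow> 'h \<Rightarrow> 'h"
  hinner :: "'h \<Rightarrow> 'h \<Rightarrow> complex"

definition hnorm :: "'h hilbert_data \<Rightarrow> 'h \<Rightarrow> real" where
  "hnorm H x = sqrt (Re (hinner H x x))"

text \<open>The value off the carrier is irrelevant; it is set to \<open>0\<close> because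
  \<^locale>\<open>Metric_space\<close> demands a symmetric nonnegative function on the whole type.\<close>

definition hdist :: "'h::ab_group_add hilbert_data \<Rightarrow> 'h \<Rightarrow> 'h \<Rightarrow> real" where
  "hdist H x y = (if x \<in> hcarrier H \<and> y \<in> hcarrier H then hnorm H (x - y) else 0)"

locale complex_inner_product_space = vector_space "hscale H"
  for H :: "'h::ab_group_add hilbert_data" +
  assumes subspace_hcarrier: "subspace (hcarrier H)"
    and hinner_add_left: "\<lbrakk>x \<in> hcarrier H; y \<in> hcarrier H; z \<in> hcarrier H\<rbrakk>
      \<Longrightarrow> hinner H (x + y) z = hinner H x z + hinner H y z"
    and hinner_scale_left: "\<lbrakk>x \<in> hcarrier H; y \<in> hcarrier H\<rbrakk>
      \<Longrightarrow> hinner H (hscale H c x) y = c * hinner H x y"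
    and hinner_commute: "\<lbrakk>x \<in> hcarrier H; y \<in> hcarrier H\<rbrakk>
      \<Longrightarrow> hinner H y x = cnj (hinner H x y)"
    and hinner_pos: "\<lbrakk>x \<in> hcarrier H; x \<noteq> 0\<rbrakk> \<Longrightarrow> 0 < Re (hinner H x x)"

locale complex_hilbert_space = complex_inner_product_space +
  assumes complete: "Metric_space.mcomplete (hcarrier H) (hdist H)"

context complex_inner_product_space
begin

lemma hinner_add_right:
  assumes "x \<in> hcarrier H" "y \<in> hcarrier H" "z \<in> hcarrier H"
  shows "hinner H z (x + y) = hinner H z x + hinner H z y"
  using assms subspace_add[OF subspace_hcarrier]
  by (metis complex_cnj_add hinner_add_left hinner_commute)

lemma hinner_scale_right:
  assumes "x \<in> hcarrier H" "y \<in> hcarrier H"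
  shows "hinner H x (hscale H c y) = cnj c * hinner H x y"
  using assms subspace_scale[OF subspace_hcarrier]
  by (metis complex_cnj_mult hinner_commute hinner_scale_left)

lemma hinner_zero_left: "x \<in> hcarrier H \<Longrightarrow> hinner H 0 x = 0"
  using hinner_scale_left[of x x 0] by simp

lemma hinner_ge_zero: "x \<in> hcarrier H \<Longrightarrow> 0 \<le> Re (hinner H x x)"
  by (cases "x = 0") (auto simp: hinner_zero_left dest: hinner_pos)

lemma hnorm_expand:
  assumes "x \<in> hcarrier H" "y \<in> hcarrier H"
  shows "Re (hinner H (x + hscale H (of_real t) y) (x + hscale H (of_real t) y))
    = Re (hinner H x x) + 2 * t * Re (hinner H x y) + t\<^sup>2 * Re (hinner H y y)"
proof -
  have "hscale H (of_real t) y \<in> hcarrier H" "x + hscale H (of_real t) y \<in> hcarrier H"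
    using assms by (auto intro: subspace_add subspace_scale subspace_hcarrier)
  then show ?thesis
    using assms hinner_commute[of x y]
    by (simp add: hinner_add_left hinner_add_right hinner_scale_left hinner_scale_right
        algebra_simps power2_eq_square)
qed

lemma Re_hinner_le:
  assumes "x \<in> hcarrier H" "y \<in> hcarrier H"
  shows "Re (hinner H x y) \<le> hnorm H x * hnorm H y"
proof (cases "y = 0")
  case True
  then show ?thesis
    using assms hinner_commute[of y x] by (simp add: hinner_zero_left hnorm_def)
next
  case False
  define p q r where "p = Re (hinner H x x)" and "q = Re (hinner H x y)"
    and "r = Re (hinner H y y)"
  have r: "r > 0" using hinner_pos False assms unfolding r_def by blast
  define t where "t = - q / r"
  have "x + hscale H (of_real t) y \<in> hcarrier H"
    using assms by (auto intro: subspace_add subspace_scale subspace_hcarrier)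
  then have "0 \<le> p + 2 * t * q + t\<^sup>2 * r"
    using hinner_ge_zero hnorm_expand[OF assms, of t] unfolding p_def q_def r_def by metis
  also have "\<dots> = p - q\<^sup>2 / r"
    using r unfolding t_def by (simp add: field_simps power2_eq_square)
  finally have "q\<^sup>2 \<le> p * r" using r by (simp add: field_simps)
  then have "\<bar>q\<bar> \<le> sqrt (p * r)" by (metis real_sqrt_abs real_sqrt_le_mono)
  then show ?thesis unfolding hnorm_def p_def q_def r_def by (simp add: real_sqrt_mult)
qed

lemma hnorm_triangle:
  assumes "x \<in> hcarrier H" "y \<in> hcarrier H"
  shows "hnorm H (x + y) \<le> hnorm H x + hnorm H y"
proof -
  have "Re (hinner H (x + y) (x + y)) \<le> (hnorm H x + hnorm H y)\<^sup>2"
    using hnorm_expand[OF assms, of 1] Re_hinner_le[OF assms] hinner_ge_zero assms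
    by (simp add: hnorm_def power2_sum)
  then show ?thesis
    using assms by (simp add: hnorm_def hinner_ge_zero real_le_lsqrt)
qed

lemma Metric_space_hdist: "Metric_space (hcarrier H) (hdist H)"
proof
  have diff: "x - y \<in> hcarrier H" if "x \<in> hcarrier H" "y \<in> hcarrier H" for x y
    using that subspace_diff[OF subspace_hcarrier] by blast
  show "0 \<le> hdist H x y" for x y
    by (auto simp: hdist_def hnorm_def hinner_ge_zero diff)
  show "hdist H x y = hdist H y x" for x y
  proof -
    have "hnorm H (x - y) = hnorm H (y - x)" if "x \<in> hcarrier H" "y \<in> hcarrier H"
    proof -
      have "y - x = hscale H (-1) (x - y)" by simp
      moreover have "hinner H (hscale H (-1) (x - y)) (hscale H (-1) (x - y))
          = hinner H (x - y) (x - y)"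
        using diff[OF that] subspace_scale[OF subspace_hcarrier diff[OF that], of "-1"]
        by (simp only: hinner_scale_left hinner_scale_right) simp
      ultimately show ?thesis by (simp only: hnorm_def)
    qed
    then show ?thesis by (auto simp: hdist_def)
  qed
  show "hdist H x y = 0 \<longleftrightarrow> x = y" if "x \<in> hcarrier H" "y \<in> hcarrier H" for x y
    using that hinner_pos[OF diff[OF that]] hinner_zero_left[OF subspace_0[OF subspace_hcarrier]]
    by (cases "x = y") (simp_all add: hdist_def hnorm_def)
  show "hdist H x z \<le> hdist H x y + hdist H y z"
    if "x \<in> hcarrier H" "y \<in> hcarrier H" "z \<in> hcarrier H" for x y z
    using hnorm_triangle[OF diff[OF that(1,2)] diff[OF that(2,3)]] that
    by (simp add: hdist_def)
qed

end

section \<open>Bounded operators\<close>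

text \<open>Operators are functions on the type of which only the restriction to the carrier
  matters; accordingly, equations between operators are stated pointwise on the carrier.\<close>

definition bounded_operator :: "'h::ab_group_add hilbert_data \<Rightarrow> ('h \<Rightarrow> 'h) \<Rightarrow> bool" where
  "bounded_operator H T \<longleftrightarrow>
     T \<in> hcarrier H \<rightarrow> hcarrier H \<and>
     (\<forall>x\<in>hcarrier H. \<forall>y\<in>hcarrier H. T (x + y) = T x + T y) \<and>
     (\<forall>c. \<forall>x\<in>hcarrier H. T (hscale H c x) = hscale H c (T x)) \<and>
     (\<exists>B. \<forall>x\<in>hcarrier H. hnorm H (T x) \<le> B * hnorm H x)"

definition op_norm :: "'h::ab_group_add hilbert_data \<Rightarrow> ('h \<Rightarrow> 'h) \<Rightarrow> real" where
  "op_norm H T = (SUP x\<in>{x \<in> hcarrier H. hnorm H x \<le> 1}. hnorm H (T x))"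

definition contraction :: "'h::ab_group_add hilbert_data \<Rightarrow> ('h \<Rightarrow> 'h) \<Rightarrow> bool" where
  "contraction H T \<longleftrightarrow> bounded_operator H T \<and> op_norm H T \<le> 1"

definition is_adjoint ::
    "'h::ab_group_add hilbert_data \<Rightarrow> ('h \<Rightarrow> 'h) \<Rightarrow> ('h \<Rightarrow> 'h) \<Rightarrow> bool" where
  "is_adjoint H T S \<longleftrightarrow>
     bounded_operator H T \<and> bounded_operator H S \<and>
     (\<forall>x\<in>hcarrier H. \<forall>y\<in>hcarrier H. hinner H (T x) y = hinner H x (S y))"

definition unitary_operator :: "'h::ab_group_add hilbert_data \<Rightarrow> ('h \<Rightarrow> 'h) \<Rightarrow> bool" where
  "unitary_operator H U \<longleftrightarrow>
     (\<exists>V. is_adjoint H U V \<and> (\<forall>x\<in>hcarrier H. V (U x) = x \<and> U (V x) = x))"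

section \<open>Covariant representations\<close>

definition representation ::
    "'h::ab_group_add hilbert_data \<Rightarrow> ('a::unital_cstar_algebra \<Rightarrow> 'h \<Rightarrow> 'h) \<Rightarrow> bool" where
  "representation H \<pi> \<longleftrightarrow>
     (\<forall>a. bounded_operator H (\<pi> a)) \<and>
     (\<forall>a b. \<forall>x\<in>hcarrier H. \<pi> (a + b) x = \<pi> a x + \<pi> b x) \<and>
     (\<forall>c a. \<forall>x\<in>hcarrier H. \<pi> (scaleC c a) x = hscale H c (\<pi> a x)) \<and>
     (\<forall>a b. \<forall>x\<in>hcarrier H. \<pi> (a * b) x = \<pi> a (\<pi> b x)) \<and>
     (\<forall>a. is_adjoint H (\<pi> a) (\<pi> (star a))) \<and>
     (\<forall>x\<in>hcarrier H. \<pi> 1 x = x)"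

definition covariant_representation ::
    "('a::unital_cstar_algebra \<Rightarrow> 'a) \<Rightarrow> 'h::ab_group_add hilbert_data \<Rightarrow>
     ('a \<Rightarrow> 'h \<Rightarrow> 'h) \<Rightarrow> ('h \<Rightarrow> 'h) \<Rightarrow> bool" where
  "covariant_representation \<alpha> H \<pi> T \<longleftrightarrow>
     representation H \<pi> \<and> contraction H T \<and>
     (\<forall>a. \<forall>x\<in>hcarrier H. T (\<pi> (\<alpha> a) x) = \<pi> a (T x))"

section \<open>Subspaces and orthogonal projections\<close>

text \<open>An identification of \<open>H\<close> with a closed subspace of \<open>K\<close>.\<close>

definition hilbert_embedding ::
    "'h::ab_group_add hilbert_data \<Rightarrow> 'k::ab_group_add hilbert_data \<Rightarrow> ('h \<Rightarrow> 'k) \<Rightarrow> bool" where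
  "hilbert_embedding H K J \<longleftrightarrow>
     J \<in> hcarrier H \<rightarrow> hcarrier K \<and>
     (\<forall>x\<in>hcarrier H. \<forall>y\<in>hcarrier H. J (x + y) = J x + J y) \<and>
     (\<forall>c. \<forall>x\<in>hcarrier H. J (hscale H c x) = hscale K c (J x)) \<and>
     (\<forall>x\<in>hcarrier H. \<forall>y\<in>hcarrier H. hinner K (J x) (J y) = hinner H x y) \<and>
     closedin (Metric_space.mtopology (hcarrier K) (hdist K)) (J ` hcarrier H)"

text \<open>Meaningful for a closed subspace \<open>M\<close> of a Hilbert space \<open>K\<close> and \<open>x\<close> in \<open>K\<close>.\<close>

definition orth_proj :: "'h::ab_group_add hilbert_data \<Rightarrow> 'h set \<Rightarrow> 'h \<Rightarrow> 'h" where
  "orth_proj K M x = (THE p. p \<in> M \<and> (\<forall>m\<in>M. hinner K (x - p) m = 0))"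

text \<open>HOL cannot quantify existentially over types, so a theorem asserting the existence of
  a Hilbert space \<open>K\<close> has to name a type for its vectors.  The following type is large enough:
  if \<open>U\<close> is unitary and \<open>(\<sigma>, U)\<close> is covariant on some \<open>K\<close> containing \<open>H\<close>, then
  \<open>U\<^sup>* \<sigma>(a) = \<sigma>(\<alpha>(a)) U\<^sup>*\<close>, so the vectors \<open>v(n,a,m,h) = U\<^sup>n \<sigma>(a) U\<^sup>m h\<close> with
  \<open>n\<close> a natural number, \<open>m\<close> an integer, \<open>a\<close> in the algebra and \<open>h\<close> in \<open>H\<close> span the smallest
  subspace containing \<open>H\<close> that reduces \<open>\<sigma>\<close> and \<open>U\<close>.  A vector \<open>x\<close> of its closure is determined
  by the function mapping \<open>(n,a,m,h)\<close> to the inner product of \<open>x\<close> with \<open>v(n,a,m,h)\<close>, and this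
  map is linear.\<close>

type_synonym ('a, 'h) dilation_vector = "nat \<times> 'a \<times> int \<times> 'h \<Rightarrow> complex"

end

theory Submission
  imports Defs
begin

text \<open>The conclusion links \<open>U\<close> to \<open>T\<close>, and \<open>\<sigma>\<close> to \<open>U\<close>, but leaves open how \<open>\<sigma>\<close> acts on the copy of \<open>H\<close>.
This makes room for a tensor product.  Let \<open>V\<close> be a unitary power dilation of \<open>T\<close> in the sense of
Sz.-Nagy, and let \<open>(\<rho>, W)\<close> be a covariant representation with \<open>W\<close> unitary and with a unit vector
\<open>e\<close> such that \<open>W e = e\<close>.  Put \<open>U = V \<otimes> W\<close> and \<open>\<sigma>(a) = 1 \<otimes> \<rho>(a)\<close>, and embed \<open>H\<close> by
\<open>h \<mapsto> h \<otimes> e\<close>.  Covariance of \<open>(\<rho>, W)\<close> gives that of \<open>(\<sigma>, U)\<close>, and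
\<open>\<langle>U\<^sup>n (h \<otimes> e), g \<otimes> e\<rangle> = \<langle>V\<^sup>n h, g\<rangle> \<langle>W\<^sup>n e, e\<rangle> = \<langle>T\<^sup>n h, g\<rangle>\<close>,
which says that the compression of \<open>U\<^sup>n\<close> to the copy of \<open>H\<close> is \<open>T\<^sup>n\<close>.

Such a triple \<open>(\<rho>, W, e)\<close> amounts to a state \<open>\<phi>\<close> with \<open>\<phi> \<circ> \<alpha> = \<phi>\<close>, namely
\<open>\<phi>(a) = \<langle>\<rho>(a) e, e\<rangle>\<close>.  An invariant state arises from any vector state \<open>\<omega>\<close> of \<open>\<pi>\<close> as a limit point
of the averages of \<open>\<omega>, \<omega> \<circ> \<alpha>, \<omega> \<circ> \<alpha>\<^sup>2, \<dots>\<close> (lemma \<open>invariant_positive_functional\<close>).  The averages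
lie in a compact set because a positive functional is bounded by its value at \<open>1\<close>, uniformly in
the functional; this rests on the square root of \<open>1 - a\<close> for self-adjoint \<open>a\<close> of norm less than \<open>1\<close>.

The spaces on which \<open>V\<close> and \<open>W\<close> act are not built separately.  The vectors
\<open>U\<^sup>n \<sigma>(a) U\<^sup>m (h \<otimes> e) = V\<^bsup>n+m\<^esup> h \<otimes> W\<^sup>n \<rho>(a) e\<close>, indexed by quadruples \<open>(n, a, m, h)\<close>, should span \<open>K\<close>,
and their inner products can be written down from \<open>T\<close> and \<open>\<phi>\<close> alone:
\<open>\<langle>V\<^sup>i h, V\<^sup>j g\<rangle>\<close> is \<open>\<langle>T\<^bsup>i-j\<^esup> h, g\<rangle>\<close> or \<open>\<langle>h, T\<^bsup>j-i\<^esup> g\<rangle>\<close>, and applying \<open>W\<^bsup>-n-p\<^esup>\<close> to both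
arguments gives \<open>\<langle>W\<^sup>n \<rho>(a) e, W\<^sup>p \<rho>(b) e\<rangle> = \<phi>(\<alpha>\<^sup>n(b)\<^sup>* \<alpha>\<^sup>p(a))\<close>.  Both kernels are positive
definite (\<open>positive_kernel_nagy_form\<close>, \<open>positive_kernel_state_form\<close>), hence so is their product by
Schur's theorem (\<open>positive_kernel_mult\<close>), and \<open>K\<close> is the reproducing kernel Hilbert space of the
product.  An element of \<open>K\<close> is the function of its inner products with the spanning vectors.  As
\<open>U\<^sup>*\<close> and \<open>\<sigma>(b)\<^sup>*\<close> map spanning vectors to spanning vectors, \<open>U\<close> and \<open>\<sigma>(b)\<close> are
composition operators, so that multiplicativity and covariance become identities between maps of the index set.\<close>

section \<open>Square roots in C*-algebras\<close>

context unital_cstar_algebra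
begin

lemma star_zero [simp]: "star 0 = 0"
  using star_add[of 0 0] by simp

end

lemma star_one [simp]: "star (1::'a::unital_cstar_algebra) = 1"
  using star_mult[of 1 "star (1::'a)"] by (simp add: star_star)

lemma star_scaleR: "star (r *\<^sub>R a) = r *\<^sub>R star (a::'a::unital_cstar_algebra)"
  by (simp add: scaleR_scaleC star_scaleC)

lemma norm_star_le: "norm a \<le> norm (star (a::'a::unital_cstar_algebra))"
proof (cases "norm a = 0")
  case False
  have "norm a * norm a \<le> norm (star a) * norm a"
    using norm_mult_ineq[of "star a" a] by (simp add: cstar_identity power2_eq_square)
  with False show ?thesis by (simp add: mult_le_cancel_right)
qed simp

lemma norm_star: "norm (star a) = norm (a::'a::unital_cstar_algebra)"
  using norm_star_le[of a] norm_star_le[of "star a"] by (simp add: star_star)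

lemma bounded_linear_star: "bounded_linear (star :: 'a::unital_cstar_algebra \<Rightarrow> 'a)"
  by (rule bounded_linear_intro[where K=1]) (simp_all add: star_add star_scaleR norm_star)

lemma star_power: "star (a ^ n) = star (a::'a::unital_cstar_algebra) ^ n"
  by (induction n) (simp_all add: star_mult power_commutes)

text \<open>The factor \<open>1 + norm 1\<close> takes care of \<open>n = 0\<close>; it does not depend on \<open>n\<close>, so it is harmless for summability.\<close>
lemma norm_power_le: "norm (a ^ n) \<le> norm (a::'a::unital_cstar_algebra) ^ n * (1 + norm (1::'a))"
proof (induction n)
  case (Suc n)
  have "norm (a ^ Suc n) \<le> norm a * norm (a ^ n)" by (simp add: norm_mult_ineq)
  also have "\<dots> \<le> norm a * (norm a ^ n * (1 + norm (1::'a)))"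
    by (rule mult_left_mono[OF Suc]) simp
  finally show ?case by (simp add: mult.assoc)
qed simp

text \<open>The binomial series of \<open>(1 - a)\<^bsup>1/2\<^esup>\<close> converges absolutely because its radius of convergence is
\<open>1\<close>, and its Cauchy square is \<open>1 - a\<close> by Vandermonde's identity.  It is self-adjoint because the
coefficients are real and the involution is continuous.\<close>
lemma sqrt_one_minus:
  fixes a :: "'a::unital_cstar_algebra"
  assumes sa: "star a = a" and less: "norm a < 1"
  obtains c where "star c = c" "c * c = 1 - a"
proof -
  define g where "g n = (1/2 gchoose n :: real)" for n
  define f where "f n = ((-1) ^ n * g n) *\<^sub>R a ^ n" for n
  have "summable (\<lambda>n. norm (g n * norm a ^ n))"
    unfolding g_def
    using less by (intro abs_summable_in_conv_radius) (auto simp: conv_radius_gchoose one_ereal_def)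
  then have sum: "summable (\<lambda>n. norm (f n))"
  proof (rule summable_comparison_test'[OF summable_mult2[of _ "1 + norm (1::'a)"], where N=0])
    fix n
    have "norm (f n) \<le> \<bar>g n\<bar> * (norm a ^ n * (1 + norm (1::'a)))"
      unfolding f_def using norm_power_le[of a n] by (auto simp: abs_mult intro: mult_left_mono)
    then show "norm (norm (f n)) \<le> norm (g n * norm a ^ n) * (1 + norm (1::'a))"
      by (simp add: abs_mult mult.assoc)
  qed
  define c where "c = suminf f"
  have "star c = (\<Sum>n. star (f n))"
    unfolding c_def using bounded_linear.suminf[OF bounded_linear_star summable_norm_cancel[OF sum]] .
  also have "\<dots> = c"
    unfolding c_def f_def by (simp add: star_scaleR star_power sa)
  finally have star: "star c = c" .
  have conv: "(\<Sum>i\<le>k. f i * f (k - i)) = ((-1) ^ k * of_nat (1 choose k)) *\<^sub>R a ^ k" for k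
  proof -
    have "(\<Sum>i\<le>k. f i * f (k - i)) = (\<Sum>i\<le>k. ((-1) ^ k * (g i * g (k - i))) *\<^sub>R a ^ k)"
      by (rule sum.cong) (auto simp: f_def power_add[symmetric] mult_ac)
    also have "\<dots> = ((-1) ^ k * (\<Sum>i\<le>k. g i * g (k - i))) *\<^sub>R a ^ k"
      by (simp only: scaleR_left.sum sum_distrib_left)
    also have "(\<Sum>i\<le>k. g i * g (k - i)) = of_nat (1 choose k)"
      unfolding g_def using gbinomial_Vandermonde[of "1/2::real" "1/2" k]
      by (simp add: binomial_gbinomial atLeast0AtMost)
    finally show ?thesis .
  qed
  have "c * c = (\<Sum>k. ((-1) ^ k * of_nat (1 choose k)) *\<^sub>R a ^ k)"
    unfolding c_def Cauchy_product[OF sum sum] conv ..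
  also have "\<dots> = (\<Sum>k\<in>{0,1}. ((-1) ^ k * of_nat (1 choose k)) *\<^sub>R a ^ k)"
    by (rule suminf_finite) (auto intro: binomial_eq_0)
  also have "\<dots> = 1 - a" by simp
  finally show ?thesis using that star by blast
qed

section \<open>Positive functionals and invariant averages\<close>

definition positive_functional :: "('a::unital_cstar_algebra \<Rightarrow> complex) \<Rightarrow> bool" where
  "positive_functional \<phi> \<longleftrightarrow>
     (\<forall>a b. \<phi> (a + b) = \<phi> a + \<phi> b) \<and>
     (\<forall>c a. \<phi> (scaleC c a) = c * \<phi> a) \<and>
     (\<forall>a. \<phi> (star a) = cnj (\<phi> a)) \<and>
     (\<forall>a. 0 \<le> Re (\<phi> (star a * a)))"

lemma positive_functionalD:
  assumes "positive_functional \<phi>"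
  shows "\<phi> (a + b) = \<phi> a + \<phi> b" "\<phi> (scaleC c a) = c * \<phi> a" "\<phi> (star a) = cnj (\<phi> a)"
    "0 \<le> Re (\<phi> (star a * a))"
  using assms unfolding positive_functional_def by blast+

lemma positive_functional_scaleR:
  "positive_functional \<phi> \<Longrightarrow> \<phi> (r *\<^sub>R a) = of_real r * \<phi> a"
  by (simp add: scaleR_scaleC positive_functionalD)

lemma positive_functional_diff:
  assumes "positive_functional \<phi>"
  shows "\<phi> (a - b) = \<phi> a - \<phi> b"
  using positive_functionalD(1)[OF assms, of "a - b" b] by simp

text \<open>Apply \<open>\<phi>\<close> to \<open>1 - a / M = c\<^sup>* c\<close>.  The bound depends on \<open>\<phi>\<close> only through \<open>\<phi>(1)\<close>,
which makes it uniform over all functionals \<open>\<phi> \<circ> \<alpha>\<^sup>n\<close>, without any continuity of \<open>\<alpha>\<close>.\<close>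
lemma positive_functional_self_adjoint_le:
  assumes \<phi>: "positive_functional \<phi>" and sa: "star a = a" and less: "norm a < M"
  shows "Re (\<phi> a) \<le> M * Re (\<phi> 1)"
proof -
  have M: "M > 0" using less norm_ge_zero[of a] by linarith
  have "norm ((1/M) *\<^sub>R a) = norm a / M" using M by simp
  then have "star ((1/M) *\<^sub>R a) = (1/M) *\<^sub>R a" "norm ((1/M) *\<^sub>R a) < 1"
    using less M by (simp_all add: star_scaleR sa)
  then obtain c where c: "star c = c" "c * c = 1 - (1/M) *\<^sub>R a"
    by (rule sqrt_one_minus)
  have "0 \<le> Re (\<phi> (1 - (1/M) *\<^sub>R a))"
    using positive_functionalD(4)[OF \<phi>, of c] c by simp
  also have "\<dots> = Re (\<phi> 1) - Re (\<phi> a) / M"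
    by (simp add: positive_functional_diff[OF \<phi>] positive_functional_scaleR[OF \<phi>])
  finally have "Re (\<phi> a) / M \<le> Re (\<phi> 1)" by simp
  then show ?thesis using M by (simp add: pos_divide_le_eq mult.commute)
qed

lemma positive_functional_Re_bound:
  assumes \<phi>: "positive_functional \<phi>"
  shows "\<bar>Re (\<phi> a)\<bar> \<le> (norm a + 1) * Re (\<phi> 1)"
proof -
  have *: "Re (\<phi> b) \<le> (norm b + 1) * Re (\<phi> 1)" for b
  proof -
    have "norm (b + star b) < 2 * (norm b + 1)"
      using norm_triangle_ineq[of b "star b"] by (simp add: norm_star)
    moreover have "star (b + star b) = b + star b"
      by (simp add: star_add star_star add.commute)
    ultimately have "Re (\<phi> (b + star b)) \<le> 2 * (norm b + 1) * Re (\<phi> 1)"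
      using positive_functional_self_adjoint_le[OF \<phi>] by blast
    moreover have "Re (\<phi> (b + star b)) = 2 * Re (\<phi> b)"
      by (simp add: positive_functionalD[OF \<phi>])
    ultimately have "2 * Re (\<phi> b) \<le> 2 * ((norm b + 1) * Re (\<phi> 1))"
      by (simp only: mult.assoc)
    then show ?thesis by (simp only: mult_le_cancel_left_pos[OF zero_less_numeral])
  qed
  have "\<phi> (- a) = - \<phi> a"
    using positive_functional_scaleR[OF \<phi>, of "-1" a] by simp
  then show ?thesis using *[of a] *[of "- a"] by simp
qed

lemma positive_functional_bound:
  assumes \<phi>: "positive_functional \<phi>"
  shows "cmod (\<phi> a) \<le> 2 * (norm a + 1) * Re (\<phi> 1)"
proof -
  have "\<bar>Im (\<phi> a)\<bar> = \<bar>Re (\<phi> (scaleC \<i> a))\<bar>"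
    by (simp add: positive_functionalD[OF \<phi>])
  also have "\<dots> \<le> (norm a + 1) * Re (\<phi> 1)"
    using positive_functional_Re_bound[OF \<phi>, of "scaleC \<i> a"] by (simp add: norm_scaleC)
  finally show ?thesis
    using cmod_le[of "\<phi> a"] positive_functional_Re_bound[OF \<phi>, of a] by linarith
qed

text \<open>Tychonoff's theorem.  The limit is taken along a filter and not along a subsequence, since the
product is over a possibly uncountable index set and need not be sequentially compact.\<close>
lemma bounded_sequence_cluster_point:
  fixes \<psi> :: "nat \<Rightarrow> 'x \<Rightarrow> complex"
  assumes bound: "\<And>n x. cmod (\<psi> n x) \<le> R x"
  obtains G \<phi> where "G \<noteq> bot" "G \<le> sequentially" "\<And>x. ((\<lambda>n. \<psi> n x) \<longlongrightarrow> \<phi> x) G"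
proof -
  have "compactin (product_topology (\<lambda>x. euclidean) UNIV) (PiE UNIV (\<lambda>x. cball (0::complex) (R x)))"
    unfolding compactin_PiE by (auto simp: compact_cball)
  then have "compact (PiE UNIV (\<lambda>x. cball (0::complex) (R x)))"
    by (simp add: euclidean_product_topology)
  moreover have "filtermap \<psi> sequentially \<noteq> bot" by (simp add: filtermap_bot_iff)
  moreover have "eventually (\<lambda>f. f \<in> PiE UNIV (\<lambda>x. cball (0::complex) (R x))) (filtermap \<psi> sequentially)"
    using bound by (simp add: eventually_filtermap PiE_iff)
  ultimately obtain \<phi> where \<phi>: "inf (nhds \<phi>) (filtermap \<psi> sequentially) \<noteq> bot"
    unfolding compact_filter by blast
  \<comment> \<open>the trace on the index set of the neighbourhoods of the cluster point\<close>
  define G where "G = inf sequentially (filtercomap \<psi> (nhds \<phi>))"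
  have "G \<noteq> bot"
  proof
    assume "G = bot"
    then have "eventually (\<lambda>_. False) G" by simp
    then obtain P Q where P: "eventually P sequentially" and Q: "eventually Q (filtercomap \<psi> (nhds \<phi>))"
      and PQ: "\<And>n. P n \<Longrightarrow> Q n \<Longrightarrow> False"
      unfolding G_def eventually_inf by blast
    from Q obtain S where S: "eventually S (nhds \<phi>)" "\<And>n. S (\<psi> n) \<Longrightarrow> Q n"
      unfolding eventually_filtercomap by blast
    have "eventually (\<lambda>f. \<not> S f) (filtermap \<psi> sequentially)"
      unfolding eventually_filtermap using P by (rule eventually_mono) (use PQ S in blast)
    with S(1) have "eventually (\<lambda>_. False) (inf (nhds \<phi>) (filtermap \<psi> sequentially))"
      unfolding eventually_inf by (intro exI[of _ S] exI[of _ "\<lambda>f. \<not> S f"]) auto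
    with \<phi> show False by (simp add: trivial_limit_def)
  qed
  moreover have "((\<lambda>n. \<psi> n x) \<longlongrightarrow> \<phi> x) G" for x
  proof -
    have "filterlim \<psi> (nhds \<phi>) G"
      unfolding G_def filterlim_def by (meson filtermap_filtercomap filtermap_mono inf_le2 order_trans)
    then show ?thesis
      using continuous_on_tendsto_compose[OF continuous_on_product_coordinates[of x], of \<psi> \<phi> G] by simp
  qed
  ultimately show ?thesis using that[of G \<phi>] by (simp add: G_def)
qed

lemma unital_star_endomorphismD:
  assumes "unital_star_endomorphism \<alpha>"
  shows "\<alpha> (a + b) = \<alpha> a + \<alpha> b" "\<alpha> (scaleC c a) = scaleC c (\<alpha> a)" "\<alpha> (a * b) = \<alpha> a * \<alpha> b"
    "\<alpha> (star a) = star (\<alpha> a)" "\<alpha> 1 = 1"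
  using assms unfolding unital_star_endomorphism_def by blast+

lemma unital_star_endomorphism_funpow:
  "unital_star_endomorphism \<alpha> \<Longrightarrow> unital_star_endomorphism (\<alpha> ^^ n)"
  by (induction n) (simp_all add: unital_star_endomorphism_def)

lemma positive_functional_compose:
  "positive_functional \<phi> \<Longrightarrow> unital_star_endomorphism \<beta> \<Longrightarrow> positive_functional (\<lambda>a. \<phi> (\<beta> a))"
  unfolding positive_functional_def unital_star_endomorphism_def by metis

text \<open>A limit point of the Cesaro means of \<open>\<omega> \<circ> \<alpha>\<^sup>n\<close>.  Composing the mean of order \<open>N\<close> with \<open>\<alpha>\<close>
changes only its first and last terms, which is an error of order \<open>1 / N\<close>.\<close>
lemma invariant_positive_functional:
  fixes \<alpha> :: "'a::unital_cstar_algebra \<Rightarrow> 'a" and \<omega> :: "'a \<Rightarrow> complex"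
  assumes \<alpha>: "unital_star_endomorphism \<alpha>" and \<omega>: "positive_functional \<omega>"
  obtains \<phi> where "positive_functional \<phi>" "\<And>a. \<phi> (\<alpha> a) = \<phi> a" "\<phi> 1 = \<omega> 1"
proof -
  define \<omega>n where "\<omega>n n a = \<omega> ((\<alpha> ^^ n) a)" for n a
  have pos: "positive_functional (\<omega>n n)" for n
    using positive_functional_compose[OF \<omega> unital_star_endomorphism_funpow[OF \<alpha>]]
    by (simp add: \<omega>n_def[abs_def])
  have one: "\<omega>n n 1 = \<omega> 1" for n
    unfolding \<omega>n_def by (simp add: unital_star_endomorphismD[OF unital_star_endomorphism_funpow[OF \<alpha>]])
  define R where "R a = 2 * (norm a + 1) * Re (\<omega> 1)" for a :: 'a
  have bound: "cmod (\<omega>n n a) \<le> R a" for n a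
    using positive_functional_bound[OF pos, of n a] by (simp add: R_def one)
  define \<psi> where "\<psi> N a = (\<Sum>n\<le>N. \<omega>n n a) / of_nat (Suc N)" for N a
  have "cmod (\<psi> N a) \<le> R a" for N a
  proof -
    have "cmod (\<Sum>n\<le>N. \<omega>n n a) \<le> (\<Sum>n\<le>N. R a)"
      by (rule sum_norm_le) (rule bound)
    then show ?thesis
      unfolding \<psi>_def norm_divide norm_of_nat by (simp add: divide_le_eq mult.commute del: of_nat_Suc)
  qed
  then obtain G \<phi> where G: "G \<noteq> bot" "G \<le> sequentially"
    and lim: "\<And>a. ((\<lambda>N. \<psi> N a) \<longlongrightarrow> \<phi> a) G"
    using bounded_sequence_cluster_point[of \<psi> R] by blast
  have \<psi>_pos: "positive_functional (\<psi> N)" for N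
    unfolding positive_functional_def
  proof (intro conjI allI)
    show "\<psi> N (a + b) = \<psi> N a + \<psi> N b" for a b
      by (simp add: \<psi>_def positive_functionalD(1)[OF pos] sum.distrib add_divide_distrib)
    show "\<psi> N (scaleC c a) = c * \<psi> N a" for c a
      by (simp add: \<psi>_def positive_functionalD(2)[OF pos] sum_distrib_left)
    show "\<psi> N (star a) = cnj (\<psi> N a)" for a
      by (simp add: \<psi>_def positive_functionalD(3)[OF pos])
    have "Re (\<psi> N (star a * a)) = (\<Sum>n\<le>N. Re (\<omega>n n (star a * a))) / of_nat (Suc N)" for a
      unfolding \<psi>_def by (simp only: Re_divide_of_nat Re_sum)
    then show "0 \<le> Re (\<psi> N (star a * a))" for a
      by (simp add: sum_nonneg positive_functionalD(4)[OF pos])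
  qed
  have unique: "\<phi> b = z" if "((\<lambda>N. \<psi> N b) \<longlongrightarrow> z) G" for b z
    using tendsto_unique[OF G(1) lim that] .
  have "positive_functional \<phi>"
    unfolding positive_functional_def
  proof (intro conjI allI)
    show "\<phi> (a + b) = \<phi> a + \<phi> b" for a b
      by (rule unique) (simp only: positive_functionalD(1)[OF \<psi>_pos] tendsto_add lim)
    show "\<phi> (scaleC c a) = c * \<phi> a" for c a
      by (rule unique) (simp only: positive_functionalD(2)[OF \<psi>_pos] tendsto_mult_left lim)
    show "\<phi> (star a) = cnj (\<phi> a)" for a
      by (rule unique) (simp only: positive_functionalD(3)[OF \<psi>_pos] tendsto_cnj lim)
    show "0 \<le> Re (\<phi> (star a * a))" for a
      by (rule tendsto_lowerbound[OF tendsto_Re[OF lim] _ G(1)])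
        (simp add: positive_functionalD(4)[OF \<psi>_pos])
  qed
  moreover have "\<phi> (\<alpha> a) = \<phi> a" for a
  proof -
    have "(\<lambda>N. (\<omega>n (Suc N) a - \<omega>n 0 a) / of_nat (Suc N)) \<longlonglongrightarrow> 0"
    proof (rule Lim_null_comparison)
      have "cmod ((\<omega>n (Suc N) a - \<omega>n 0 a) / of_nat (Suc N)) \<le> (2 * R a) * inverse (real (Suc N))" for N
        using norm_triangle_ineq4[of "\<omega>n (Suc N) a" "\<omega>n 0 a"] bound[of "Suc N" a] bound[of 0 a]
        unfolding norm_divide norm_of_nat by (simp add: divide_inverse[symmetric] divide_right_mono del: of_nat_Suc)
      then show "\<forall>\<^sub>F N in sequentially. cmod ((\<omega>n (Suc N) a - \<omega>n 0 a) / of_nat (Suc N))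
          \<le> (2 * R a) * inverse (real (Suc N))" by simp
      show "(\<lambda>N. (2 * R a) * inverse (real (Suc N))) \<longlonglongrightarrow> 0"
        using tendsto_mult_left[OF LIMSEQ_inverse_real_of_nat, of "2 * R a"] by (simp only: mult_zero_right)
    qed
    moreover have "\<psi> N (\<alpha> a) = \<psi> N a + (\<omega>n (Suc N) a - \<omega>n 0 a) / of_nat (Suc N)" for N
    proof -
      have "(\<Sum>n\<le>N. \<omega>n n (\<alpha> a)) = (\<Sum>n\<le>N. \<omega>n (Suc n) a)"
        by (simp add: \<omega>n_def funpow_swap1)
      also have "\<dots> = (\<Sum>n\<le>N. \<omega>n n a) + (\<omega>n (Suc N) a - \<omega>n 0 a)"
        using sum.atMost_Suc_shift[of "\<lambda>n. \<omega>n n a" N] by (simp add: algebra_simps)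
      finally show ?thesis by (simp only: \<psi>_def add_divide_distrib)
    qed
    ultimately have "((\<lambda>N. \<psi> N (\<alpha> a)) \<longlongrightarrow> \<phi> a + 0) G"
      by (simp only: tendsto_add lim tendsto_mono[OF G(2)])
    then show ?thesis using unique by (simp only: add_0_right)
  qed
  moreover have "\<phi> 1 = \<omega> 1"
  proof (rule unique)
    have "\<psi> N 1 = \<omega> 1" for N
      by (simp add: \<psi>_def one del: of_nat_Suc)
    then show "((\<lambda>N. \<psi> N 1) \<longlongrightarrow> \<omega> 1) G" by simp
  qed
  ultimately show ?thesis using that by blast
qed

section \<open>Positive definite kernels and Schur products\<close>

definition positive_kernel :: "('x \<Rightarrow> 'x \<Rightarrow> complex) \<Rightarrow> bool" where
  "positive_kernel k \<longleftrightarrow>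
     (\<forall>x y. k y x = cnj (k x y)) \<and>
     (\<forall>F c. finite F \<longrightarrow> 0 \<le> Re (\<Sum>x\<in>F. \<Sum>y\<in>F. c x * cnj (c y) * k x y))"

lemma positive_kernelD:
  assumes "positive_kernel k"
  shows "k y x = cnj (k x y)"
    "finite F \<Longrightarrow> 0 \<le> Re (\<Sum>x\<in>F. \<Sum>y\<in>F. c x * cnj (c y) * k x y)"
  using assms unfolding positive_kernel_def by blast+

lemma positive_kernel_diag:
  assumes "positive_kernel k"
  shows "Im (k x x) = 0" "0 \<le> Re (k x x)"
  using arg_cong[OF positive_kernelD(1)[OF assms, of x x], of Im] positive_kernelD(2)[OF assms, of "{x}" "\<lambda>_. 1"] by auto

text \<open>With \<open>k x y = \<langle>v\<^sub>x, v\<^sub>y\<rangle>\<close> this is the expansion of \<open>\<parallel>w v\<^sub>p + \<Sum> c\<^sub>x v\<^sub>x\<parallel>\<^sup>2 \<ge> 0\<close>.  The point \<open>p\<close> may lie in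
\<open>F\<close>, in which case its two coefficients are added.\<close>
lemma positive_kernel_complete_square:
  assumes k: "positive_kernel k" and F: "finite F"
  shows "0 \<le> (cmod w)\<^sup>2 * Re (k p p) + 2 * Re (cnj w * (\<Sum>x\<in>F. c x * k x p))
    + Re (\<Sum>x\<in>F. \<Sum>y\<in>F. c x * cnj (c y) * k x y)"
proof -
  define d where "d x = (if x \<in> F then c x else 0) + (if x = p then w else 0)" for x
  have d: "(\<Sum>x\<in>insert p F. d x * g x) = (\<Sum>x\<in>F. c x * g x) + w * g p" for g
  proof -
    have "(\<Sum>x\<in>insert p F. d x * g x) =
        (\<Sum>x\<in>insert p F. if x \<in> F then c x * g x else 0) + (\<Sum>x\<in>insert p F. if x = p then w * g x else 0)"
      unfolding d_def sum.distrib[symmetric] by (rule sum.cong) (auto simp: distrib_right)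
    also have "(\<Sum>x\<in>insert p F. if x \<in> F then c x * g x else 0) = (\<Sum>x\<in>F. c x * g x)"
      by (rule sum.mono_neutral_cong_right) (use F in auto)
    also have "(\<Sum>x\<in>insert p F. if x = p then w * g x else 0) = w * g p"
      using F by simp
    finally show ?thesis .
  qed
  define s where "s = (\<Sum>x\<in>F. c x * k x p)"
  have s: "(\<Sum>y\<in>F. cnj (c y) * k p y) = cnj s"
    unfolding s_def by (simp add: positive_kernelD(1)[OF k, of p])
  have d': "(\<Sum>y\<in>insert p F. cnj (d y) * g y) = (\<Sum>y\<in>F. cnj (c y) * g y) + cnj w * g p" for g
    using arg_cong[OF d[of "\<lambda>y. cnj (g y)"], of cnj] by simp
  have "(\<Sum>x\<in>insert p F. \<Sum>y\<in>insert p F. d x * cnj (d y) * k x y)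
      = (\<Sum>x\<in>insert p F. d x * (\<Sum>y\<in>insert p F. cnj (d y) * k x y))"
    by (simp add: sum_distrib_left mult.assoc)
  also have "\<dots> = (\<Sum>x\<in>F. c x * ((\<Sum>y\<in>F. cnj (c y) * k x y) + cnj w * k x p))
      + w * (cnj s + cnj w * k p p)"
    by (simp only: d d' s)
  also have "\<dots> = (\<Sum>x\<in>F. \<Sum>y\<in>F. c x * cnj (c y) * k x y) + cnj w * s + w * cnj s + w * cnj w * k p p"
    by (simp add: s_def sum_distrib_left sum.distrib algebra_simps)
  finally have "(\<Sum>x\<in>insert p F. \<Sum>y\<in>insert p F. d x * cnj (d y) * k x y)
    = (\<Sum>x\<in>F. \<Sum>y\<in>F. c x * cnj (c y) * k x y) + cnj w * s + w * cnj s + w * cnj w * k p p" .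
  moreover have "Re (w * cnj w * k p p) = (cmod w)\<^sup>2 * Re (k p p)"
    unfolding complex_norm_square[symmetric] by (simp del: of_real_power)
  moreover have "Re (w * cnj s) = Re (cnj w * s)" by simp
  ultimately have "Re (\<Sum>x\<in>insert p F. \<Sum>y\<in>insert p F. d x * cnj (d y) * k x y)
      = (cmod w)\<^sup>2 * Re (k p p) + 2 * Re (cnj w * s)
        + Re (\<Sum>x\<in>F. \<Sum>y\<in>F. c x * cnj (c y) * k x y)"
    by (simp only: plus_complex.simps)
  then show ?thesis
    using positive_kernelD(2)[OF k, of "insert p F" d] F by (simp only: s_def finite_insert)
qed

lemma positive_kernel_Cauchy_Schwarz:
  assumes k: "positive_kernel k" and F: "finite F"
  shows "(cmod (\<Sum>x\<in>F. c x * k x p))\<^sup>2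
    \<le> Re (k p p) * Re (\<Sum>x\<in>F. \<Sum>y\<in>F. c x * cnj (c y) * k x y)"
proof -
  define s Q r where "s = (\<Sum>x\<in>F. c x * k x p)"
    and "Q = Re (\<Sum>x\<in>F. \<Sum>y\<in>F. c x * cnj (c y) * k x y)" and "r = Re (k p p)"
  \<comment> \<open>take \<open>w = - t s\<close>; the minimum over \<open>t\<close> is at \<open>1 / r\<close>, and \<open>r = 0\<close> forces \<open>s = 0\<close>\<close>
  have *: "0 \<le> t\<^sup>2 * (cmod s)\<^sup>2 * r - 2 * t * (cmod s)\<^sup>2 + Q" for t
  proof -
    have "cnj (- (of_real t * s)) * s = of_real (- t * (cmod s)\<^sup>2)"
      unfolding of_real_mult complex_norm_square by simp
    then have "Re (cnj (- (of_real t * s)) * s) = - t * (cmod s)\<^sup>2"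
      by (simp only: Re_complex_of_real)
    moreover have "(cmod (- (of_real t * s)))\<^sup>2 = t\<^sup>2 * (cmod s)\<^sup>2"
      by (simp add: norm_mult power_mult_distrib)
    ultimately show ?thesis
      using positive_kernel_complete_square[OF k F, of "- (of_real t * s)" p c]
      unfolding s_def[symmetric] Q_def[symmetric] r_def[symmetric] by simp
  qed
  have r: "r \<ge> 0" unfolding r_def by (rule positive_kernel_diag[OF k])
  show ?thesis unfolding s_def[symmetric] Q_def[symmetric] r_def[symmetric]
  proof (cases "r = 0")
    case True
    have "(cmod s)\<^sup>2 = 0"
    proof (rule ccontr)
      assume "(cmod s)\<^sup>2 \<noteq> 0"
      then show False using *[of "(Q + 1) / (2 * (cmod s)\<^sup>2)"] True by simp
    qed
    then show "(cmod s)\<^sup>2 \<le> r * Q" using True by simp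
  next
    case False
    then have "0 < r" using r by simp
    with *[of "1 / r"] show "(cmod s)\<^sup>2 \<le> r * Q"
      by (simp add: field_simps power2_eq_square)
  qed
qed

lemma positive_kernel_eq_0:
  assumes k: "positive_kernel k" and "k p p = 0"
  shows "k x p = 0" "k p x = 0"
proof -
  show "k x p = 0"
    using positive_kernel_Cauchy_Schwarz[OF k, of "{x}" "\<lambda>_. 1" p] assms(2) by simp
  then show "k p x = 0" using positive_kernelD(1)[OF k, of p x] by simp
qed

text \<open>A Cholesky decomposition, one point of \<open>F\<close> at a time: subtracting the rank-one kernel
\<open>k x p * k p y / k p p\<close> leaves a kernel that is positive by the Cauchy-Schwarz inequality and vanishes at \<open>p\<close>.
If \<open>k p p = 0\<close>, then \<open>k\<close> already vanishes at \<open>p\<close>, and division by zero makes the subtracted term \<open>0\<close>.\<close>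
lemma positive_kernel_Gram:
  fixes k :: "'x \<Rightarrow> 'x \<Rightarrow> complex"
  assumes "finite F" "positive_kernel k"
  shows "\<exists>(n::nat) v. \<forall>x\<in>F. \<forall>y\<in>F. k x y = (\<Sum>i<n. v i x * cnj (v i y))"
  using assms
proof (induction F arbitrary: k rule: finite_induct)
  case empty
  then show ?case by simp
next
  case (insert p F)
  note k = insert.prems
  define l where "l x y = k x y - k x p * k p y / k p p" for x y
  have real: "k p p = of_real (Re (k p p))"
    using positive_kernel_diag[OF k, of p] by (simp add: complex_eq_iff)
  have lp: "l x p = 0" "l p x = 0" for x
    using positive_kernel_eq_0(1)[OF k _, of p x] positive_kernel_eq_0(2)[OF k _, of p x]
    by (auto simp: l_def)
  have "positive_kernel l"
    unfolding positive_kernel_def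
  proof (intro conjI allI impI)
    show "l y x = cnj (l x y)" for x y
      by (simp add: l_def positive_kernelD(1)[OF k, symmetric] mult.commute)
    fix E :: "'x set" and c :: "'x \<Rightarrow> complex" assume E: "finite E"
    define s where "s = (\<Sum>x\<in>E. c x * k x p)"
    have s: "(\<Sum>y\<in>E. cnj (c y) * k p y) = cnj s"
      unfolding s_def by (simp add: positive_kernelD(1)[OF k, of p])
    have "(\<Sum>x\<in>E. \<Sum>y\<in>E. c x * cnj (c y) * l x y)
        = (\<Sum>x\<in>E. \<Sum>y\<in>E. c x * cnj (c y) * k x y)
          - (\<Sum>x\<in>E. \<Sum>y\<in>E. (c x * k x p) * (cnj (c y) * k p y)) / k p p"
      unfolding l_def by (simp add: algebra_simps sum_subtractf sum_divide_distrib)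
    also have "(\<Sum>x\<in>E. \<Sum>y\<in>E. (c x * k x p) * (cnj (c y) * k p y)) = s * cnj s"
      by (simp only: sum_product[symmetric] s s_def)
    also have "s * cnj s / k p p = of_real ((cmod s)\<^sup>2 / Re (k p p))"
      by (subst real) (simp only: complex_norm_square of_real_divide)
    finally have eq: "Re (\<Sum>x\<in>E. \<Sum>y\<in>E. c x * cnj (c y) * l x y)
        = Re (\<Sum>x\<in>E. \<Sum>y\<in>E. c x * cnj (c y) * k x y) - (cmod s)\<^sup>2 / Re (k p p)"
      by (simp only: minus_complex.simps Re_complex_of_real)
    have div: "q / r \<le> Q" if "q \<le> r * Q" "0 \<le> r" "0 \<le> Q" for q r Q :: real
      using that by (cases "r = 0") (simp_all add: pos_divide_le_eq mult.commute)
    have "(cmod s)\<^sup>2 / Re (k p p) \<le> Re (\<Sum>x\<in>E. \<Sum>y\<in>E. c x * cnj (c y) * k x y)"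
      unfolding s_def
      by (rule div[OF positive_kernel_Cauchy_Schwarz[OF k E] positive_kernel_diag(2)[OF k] positive_kernelD(2)[OF k E]])
    with eq show "0 \<le> Re (\<Sum>x\<in>E. \<Sum>y\<in>E. c x * cnj (c y) * l x y)" by linarith
  qed
  then obtain n :: nat and v where v: "\<And>x y. x \<in> F \<Longrightarrow> y \<in> F \<Longrightarrow> l x y = (\<Sum>i<n. v i x * cnj (v i y))"
    using insert.IH by blast
  define u where "u i x = (if i < n then if x = p then 0 else v i x else k x p / of_real (sqrt (Re (k p p))))"
    for i x
  have last: "u n x * cnj (u n y) = k x p * k p y / k p p" for x y
  proof -
    have "of_real (sqrt (Re (k p p))) * of_real (sqrt (Re (k p p))) = k p p"
      using positive_kernel_diag(2)[OF k, of p] by (subst (3) real) (simp only: of_real_mult[symmetric], simp)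
    then show ?thesis
      by (simp add: u_def positive_kernelD(1)[OF k, symmetric])
  qed
  have "k x y = (\<Sum>i<Suc n. u i x * cnj (u i y))" if "x \<in> insert p F" "y \<in> insert p F" for x y
  proof -
    have "l x y = (\<Sum>i<n. u i x * cnj (u i y))"
    proof (cases "x = p \<or> y = p")
      case True
      then show ?thesis using lp by (auto simp: u_def)
    next
      case False
      then show ?thesis using that v by (simp add: u_def)
    qed
    then show ?thesis by (simp add: last) (simp add: l_def algebra_simps)
  qed
  then show ?case by blast
qed

text \<open>Schur's product theorem: once \<open>k\<close> is written as a sum of kernels \<open>v x * cnj (v y)\<close>, each summand can
be absorbed into the coefficients of the quadratic form of \<open>l\<close>.\<close>
lemma positive_kernel_mult:
  fixes k l :: "'x \<Rightarrow> 'x \<Rightarrow> complex"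
  assumes k: "positive_kernel k" and l: "positive_kernel l"
  shows "positive_kernel (\<lambda>x y. k x y * l x y)"
  unfolding positive_kernel_def
proof (intro conjI allI impI)
  show "k y x * l y x = cnj (k x y * l x y)" for x y
    using positive_kernelD(1)[OF k, of y x] positive_kernelD(1)[OF l, of y x] by simp
  fix F :: "'x set" and c :: "'x \<Rightarrow> complex" assume F: "finite F"
  obtain n :: nat and v where v: "\<And>x y. x \<in> F \<Longrightarrow> y \<in> F \<Longrightarrow> k x y = (\<Sum>i<n. v i x * cnj (v i y))"
    using positive_kernel_Gram[OF F k] by blast
  have "(\<Sum>x\<in>F. \<Sum>y\<in>F. c x * cnj (c y) * (k x y * l x y))
      = (\<Sum>x\<in>F. \<Sum>y\<in>F. \<Sum>i<n. (c x * v i x) * cnj (c y * v i y) * l x y)"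
    by (intro sum.cong refl) (simp add: v sum_distrib_left sum_distrib_right mult_ac)
  also have "\<dots> = (\<Sum>i<n. \<Sum>x\<in>F. \<Sum>y\<in>F. (c x * v i x) * cnj (c y * v i y) * l x y)"
    by (simp only: sum.swap[of _ "{..<n}" F])
  finally show "0 \<le> Re (\<Sum>x\<in>F. \<Sum>y\<in>F. c x * cnj (c y) * (k x y * l x y))"
    using positive_kernelD(2)[OF l F] by (simp only: Re_sum sum_nonneg)
qed

context complex_inner_product_space
begin

lemma hcarrier_closed:
  "0 \<in> hcarrier H"
  "x \<in> hcarrier H \<Longrightarrow> y \<in> hcarrier H \<Longrightarrow> x + y \<in> hcarrier H"
  "x \<in> hcarrier H \<Longrightarrow> y \<in> hcarrier H \<Longrightarrow> x - y \<in> hcarrier H"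
  "x \<in> hcarrier H \<Longrightarrow> hscale H c x \<in> hcarrier H"
  "(\<And>i. i \<in> A \<Longrightarrow> f i \<in> hcarrier H) \<Longrightarrow> sum f A \<in> hcarrier H"
  using subspace_hcarrier subspace_0 subspace_add subspace_diff subspace_scale subspace_sum by blast+

lemma hinner_sum_left:
  "(\<And>i. i \<in> A \<Longrightarrow> f i \<in> hcarrier H) \<Longrightarrow> x \<in> hcarrier H \<Longrightarrow>
    hinner H (sum f A) x = (\<Sum>i\<in>A. hinner H (f i) x)"
  by (induction A rule: infinite_finite_induct) (simp_all add: hinner_zero_left hinner_add_left hcarrier_closed)

lemma hinner_diff_left:
  assumes "x \<in> hcarrier H" "y \<in> hcarrier H" "z \<in> hcarrier H"
  shows "hinner H (x - y) z = hinner H x z - hinner H y z"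
  using hinner_add_left[of "x - y" y z] assms by (simp add: hcarrier_closed)

lemma hinner_diff_right:
  assumes "x \<in> hcarrier H" "y \<in> hcarrier H" "z \<in> hcarrier H"
  shows "hinner H z (x - y) = hinner H z x - hinner H z y"
  using hinner_add_right[of "x - y" y z] assms by (simp add: hcarrier_closed)

lemma hinner_self_real:
  assumes "x \<in> hcarrier H"
  shows "hinner H x x = of_real ((hnorm H x)\<^sup>2)"
  using hinner_ge_zero[OF assms] arg_cong[OF hinner_commute[OF assms assms], of Im]
  by (simp add: complex_eq_iff hnorm_def)

lemma hnorm_nonneg: "x \<in> hcarrier H \<Longrightarrow> 0 \<le> hnorm H x"
  by (simp add: hnorm_def hinner_ge_zero)

lemma hnorm_eq_0: "x \<in> hcarrier H \<Longrightarrow> hnorm H x = 0 \<longleftrightarrow> x = 0"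
  using hinner_pos[of x] by (cases "x = 0") (auto simp: hnorm_def hinner_zero_left)

lemma hnorm_scale:
  assumes x: "x \<in> hcarrier H"
  shows "hnorm H (hscale H c x) = cmod c * hnorm H x"
proof -
  have "hinner H (hscale H c x) (hscale H c x) = (c * cnj c) * hinner H x x"
    using x by (simp add: hinner_scale_left hinner_scale_right hcarrier_closed)
  then have "Re (hinner H (hscale H c x) (hscale H c x)) = (cmod c)\<^sup>2 * Re (hinner H x x)"
    unfolding complex_norm_square[symmetric] by simp
  then show ?thesis by (simp add: hnorm_def real_sqrt_mult)
qed

lemma hinner_Cauchy_Schwarz:
  assumes x: "x \<in> hcarrier H" and y: "y \<in> hcarrier H"
  shows "cmod (hinner H x y) \<le> hnorm H x * hnorm H y"
proof (cases "hinner H x y = 0")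
  case True
  then show ?thesis using hnorm_nonneg x y by simp
next
  case False
  define u where "u = cnj (hinner H x y) / of_real (cmod (hinner H x y))"
  have u: "cmod u = 1" using False by (simp add: u_def norm_divide)
  have "u * hinner H x y = of_real (cmod (hinner H x y))"
    using False complex_norm_square[of "hinner H x y"]
    by (simp add: u_def power2_eq_square mult.commute divide_eq_eq)
  then have "cmod (hinner H x y) = Re (hinner H (hscale H u x) y)"
    using x y by (simp add: hinner_scale_left)
  also have "\<dots> \<le> hnorm H (hscale H u x) * hnorm H y"
    using x y by (intro Re_hinner_le hcarrier_closed)
  finally show ?thesis using u x by (simp add: hnorm_scale)
qed

end

section \<open>The Toeplitz kernel of a contraction\<close>

text \<open>The inner product of \<open>V\<^sup>i g\<close> and \<open>V\<^sup>j h\<close> for the unitary dilation \<open>V\<close> of \<open>T\<close>.\<close>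
definition nagy_form :: "'h::ab_group_add hilbert_data \<Rightarrow> ('h \<Rightarrow> 'h) \<Rightarrow> int \<times> 'h \<Rightarrow> int \<times> 'h \<Rightarrow> complex" where
  "nagy_form H T = (\<lambda>(i, g) (j, h).
     if j \<le> i then hinner H ((T ^^ nat (i - j)) g) h else hinner H g ((T ^^ nat (j - i)) h))"

locale hilbert_contraction = complex_inner_product_space H
  for H :: "'h::ab_group_add hilbert_data" +
  fixes T :: "'h \<Rightarrow> 'h"
  assumes closed: "x \<in> hcarrier H \<Longrightarrow> T x \<in> hcarrier H"
    and add: "x \<in> hcarrier H \<Longrightarrow> y \<in> hcarrier H \<Longrightarrow> T (x + y) = T x + T y"
    and scale: "x \<in> hcarrier H \<Longrightarrow> T (hscale H c x) = hscale H c (T x)"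
    and contractive: "x \<in> hcarrier H \<Longrightarrow> hnorm H (T x) \<le> hnorm H x"
begin

lemma funpow_contraction: "hilbert_contraction H (T ^^ n)"
proof (induction n)
  case 0
  show ?case by unfold_locales auto
next
  case (Suc n)
  then interpret n: hilbert_contraction H "T ^^ n" .
  show ?case
    by unfold_locales (auto simp: closed add scale n.closed n.add n.scale intro: order_trans[OF contractive] n.contractive)
qed

lemmas pow_closed = hilbert_contraction.closed[OF funpow_contraction]
  and pow_add = hilbert_contraction.add[OF funpow_contraction]
  and pow_scale = hilbert_contraction.scale[OF funpow_contraction]
  and pow_contractive = hilbert_contraction.contractive[OF funpow_contraction]

lemma zero: "T 0 = 0"
  using add[of 0 0] by (simp add: hcarrier_closed)

lemma sum: "(\<And>i. i \<in> A \<Longrightarrow> f i \<in> hcarrier H) \<Longrightarrow> T (sum f A) = (\<Sum>i\<in>A. T (f i))"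
  by (induction A rule: infinite_finite_induct) (simp_all add: zero add hcarrier_closed)

lemmas pow_sum = hilbert_contraction.sum[OF funpow_contraction]

lemma nagy_form_add_left:
  assumes "g \<in> hcarrier H" "g' \<in> hcarrier H" "h \<in> hcarrier H"
  shows "nagy_form H T (i, g + g') (j, h) = nagy_form H T (i, g) (j, h) + nagy_form H T (i, g') (j, h)"
  using assms by (simp add: nagy_form_def pow_add hinner_add_left pow_closed)

lemma nagy_form_scale_left:
  assumes "g \<in> hcarrier H" "h \<in> hcarrier H"
  shows "nagy_form H T (i, hscale H c g) (j, h) = c * nagy_form H T (i, g) (j, h)"
  using assms by (simp add: nagy_form_def pow_scale hinner_scale_left pow_closed)

lemma nagy_form_commute:
  assumes "g \<in> hcarrier H" "h \<in> hcarrier H"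
  shows "nagy_form H T (j, h) (i, g) = cnj (nagy_form H T (i, g) (j, h))"
  using assms by (auto simp: nagy_form_def hinner_commute[symmetric] pow_closed)

lemma nagy_form_shift: "nagy_form H T (i + l, g) (j + l, h) = nagy_form H T (i, g) (j, h)"
  by (simp add: nagy_form_def)

text \<open>Horner's scheme, adding the terms in the order of decreasing \<open>m\<close>.  Adding a term \<open>h\<^sub>p\<close> of smallest
exponent to a form that dominates \<open>\<parallel>y\<parallel>\<^sup>2\<close>, where \<open>y = \<Sum> T\<^bsup>m(i) - m(p)\<^esup> h\<^sub>i\<close>, adds exactly
\<open>\<parallel>h\<^sub>p\<parallel>\<^sup>2 + 2 Re \<langle>y, h\<^sub>p\<rangle>\<close>, so that the new form dominates \<open>\<parallel>y + h\<^sub>p\<parallel>\<^sup>2\<close>.  Lowering the base exponent from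
\<open>m(p)\<close> to \<open>k\<close> applies a power of the contraction \<open>T\<close> to \<open>y + h\<^sub>p\<close>, which does not increase the norm.\<close>
lemma nagy_form_sum_ge:
  assumes "finite F" "\<And>i. i \<in> F \<Longrightarrow> h i \<in> hcarrier H" "\<And>i. i \<in> F \<Longrightarrow> k \<le> m i"
  shows "(hnorm H (\<Sum>i\<in>F. (T ^^ nat (m i - k)) (h i)))\<^sup>2
    \<le> Re (\<Sum>i\<in>F. \<Sum>j\<in>F. nagy_form H T (m i, h i) (m j, h j))"
  using assms
proof (induction F arbitrary: k rule: finite_ranking_induct[where f = "\<lambda>i. - m i"])
  case empty
  then show ?case by (simp add: hnorm_def hinner_zero_left hcarrier_closed)
next
  case (insert p F)
  show ?case
  proof (cases "p \<in> F")
    case True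
    then have "insert p F = F" by (rule insert_absorb)
    then show ?thesis using insert.IH[of k] insert.prems by metis
  next
    case False
    have hp: "h p \<in> hcarrier H" and hF: "\<And>i. i \<in> F \<Longrightarrow> h i \<in> hcarrier H"
      and k: "k \<le> m p" and mF: "\<And>i. i \<in> F \<Longrightarrow> m p \<le> m i"
      using insert.prems insert.hyps(2) by simp_all
    define y where "y = (\<Sum>i\<in>F. (T ^^ nat (m i - m p)) (h i))"
    have yc: "y \<in> hcarrier H"
      unfolding y_def by (intro hcarrier_closed pow_closed hF)
    have IH: "(hnorm H y)\<^sup>2 \<le> Re (\<Sum>i\<in>F. \<Sum>j\<in>F. nagy_form H T (m i, h i) (m j, h j))"
      unfolding y_def using insert.IH[OF hF mF] .
    have left: "(\<Sum>i\<in>F. nagy_form H T (m i, h i) (m p, h p)) = hinner H y (h p)"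
    proof -
      have "(\<Sum>i\<in>F. nagy_form H T (m i, h i) (m p, h p))
          = (\<Sum>i\<in>F. hinner H ((T ^^ nat (m i - m p)) (h i)) (h p))"
        by (rule sum.cong) (use mF in \<open>auto simp: nagy_form_def\<close>)
      then show ?thesis
        unfolding y_def by (simp add: hinner_sum_left hp hF pow_closed)
    qed
    have right: "(\<Sum>j\<in>F. nagy_form H T (m p, h p) (m j, h j)) = cnj (hinner H y (h p))"
      unfolding left[symmetric] cnj_sum by (intro sum.cong refl nagy_form_commute hp hF)
    have "nagy_form H T (m p, h p) (m p, h p) = hinner H (h p) (h p)"
      by (simp add: nagy_form_def)
    then have "(\<Sum>i\<in>insert p F. \<Sum>j\<in>insert p F. nagy_form H T (m i, h i) (m j, h j))
        = hinner H (h p) (h p) + cnj (hinner H y (h p)) + hinner H y (h p)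
          + (\<Sum>i\<in>F. \<Sum>j\<in>F. nagy_form H T (m i, h i) (m j, h j))"
      using insert.hyps(1) False by (simp add: sum.distrib left right)
    moreover have "(hnorm H (y + h p))\<^sup>2 = (hnorm H y)\<^sup>2 + 2 * Re (hinner H y (h p)) + Re (hinner H (h p) (h p))"
      using hnorm_expand[OF yc hp, of 1] hinner_ge_zero[OF yc] hinner_ge_zero[OF hcarrier_closed(2)[OF yc hp]]
      by (simp add: hnorm_def)
    ultimately have bound: "(hnorm H (y + h p))\<^sup>2
        \<le> Re (\<Sum>i\<in>insert p F. \<Sum>j\<in>insert p F. nagy_form H T (m i, h i) (m j, h j))"
      using IH by simp
    have horner: "(\<Sum>i\<in>insert p F. (T ^^ nat (m i - k)) (h i)) = (T ^^ nat (m p - k)) (y + h p)"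
    proof -
      have "(T ^^ nat (m i - k)) (h i) = (T ^^ nat (m p - k)) ((T ^^ nat (m i - m p)) (h i))" if "i \<in> F" for i
      proof -
        have "nat (m i - k) = nat (m p - k) + nat (m i - m p)" using mF[OF that] k by simp
        then show ?thesis by (simp add: funpow_add)
      qed
      then show ?thesis
        using insert.hyps(1) False hp hF yc
        by (simp add: pow_add add.commute) (simp add: y_def pow_sum pow_closed)
    qed
    have "(hnorm H ((T ^^ nat (m p - k)) (y + h p)))\<^sup>2 \<le> (hnorm H (y + h p))\<^sup>2"
      by (rule power_mono) (simp_all add: pow_contractive hnorm_nonneg pow_closed hcarrier_closed(2) yc hp)
    then show ?thesis unfolding horner using bound by (rule order_trans)
  qed
qed

lemma positive_kernel_nagy_form:
  fixes m :: "'x \<Rightarrow> int" and h :: "'x \<Rightarrow> 'h"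
  assumes h: "\<And>x. h x \<in> hcarrier H"
  shows "positive_kernel (\<lambda>x y. nagy_form H T (m x, h x) (m y, h y))"
  unfolding positive_kernel_def
proof (intro conjI allI impI)
  show "nagy_form H T (m y, h y) (m x, h x) = cnj (nagy_form H T (m x, h x) (m y, h y))" for x y
    by (rule nagy_form_commute) (rule h)+
  fix F :: "'x set" and c :: "'x \<Rightarrow> complex" assume F: "finite F"
  define k where "k = Min (insert 0 (m ` F))"
  have "c x * cnj (c y) * nagy_form H T (m x, h x) (m y, h y)
      = nagy_form H T (m x, hscale H (c x) (h x)) (m y, hscale H (c y) (h y))" for x y
  proof -
    have hc: "hscale H (c y) (h y) \<in> hcarrier H" for y by (rule hcarrier_closed(4)[OF h])
    have "nagy_form H T (m x, hscale H (c x) (h x)) (m y, hscale H (c y) (h y))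
        = c x * nagy_form H T (m x, h x) (m y, hscale H (c y) (h y))"
      by (rule nagy_form_scale_left[OF h hc])
    also have "nagy_form H T (m x, h x) (m y, hscale H (c y) (h y))
        = cnj (c y * nagy_form H T (m y, h y) (m x, h x))"
      unfolding nagy_form_scale_left[OF h h, symmetric] by (rule nagy_form_commute[OF hc h])
    also have "nagy_form H T (m y, h y) (m x, h x) = cnj (nagy_form H T (m x, h x) (m y, h y))"
      by (rule nagy_form_commute[OF h h])
    finally show ?thesis by simp
  qed
  then have "(\<Sum>x\<in>F. \<Sum>y\<in>F. c x * cnj (c y) * nagy_form H T (m x, h x) (m y, h y))
      = (\<Sum>x\<in>F. \<Sum>y\<in>F. nagy_form H T (m x, hscale H (c x) (h x)) (m y, hscale H (c y) (h y)))"
    by simp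
  moreover have "(hnorm H (\<Sum>x\<in>F. (T ^^ nat (m x - k)) (hscale H (c x) (h x))))\<^sup>2
    \<le> Re (\<Sum>x\<in>F. \<Sum>y\<in>F. nagy_form H T (m x, hscale H (c x) (h x)) (m y, hscale H (c y) (h y)))"
    by (rule nagy_form_sum_ge[OF F]) (simp_all add: k_def F hcarrier_closed(4) h)
  ultimately show "0 \<le> Re (\<Sum>x\<in>F. \<Sum>y\<in>F. c x * cnj (c y) * nagy_form H T (m x, h x) (m y, h y))"
    by (simp only:) (rule order_trans[OF zero_le_power2])
qed

end

section \<open>Cauchy sequences in inner product spaces\<close>

context complex_inner_product_space
begin

lemma hinner_sum_right:
  assumes "\<And>i. i \<in> A \<Longrightarrow> f i \<in> hcarrier H" "x \<in> hcarrier H"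
  shows "hinner H x (sum f A) = (\<Sum>i\<in>A. hinner H x (f i))"
proof -
  have "hinner H x (sum f A) = cnj (\<Sum>i\<in>A. hinner H (f i) x)"
    using hinner_commute[of "sum f A" x] assms by (simp only: hinner_sum_left hcarrier_closed)
  also have "\<dots> = (\<Sum>i\<in>A. hinner H x (f i))"
    unfolding cnj_sum by (intro sum.cong refl hinner_commute[symmetric] assms)
  finally show ?thesis .
qed

lemma hnorm_minus_commute:
  assumes "x \<in> hcarrier H" "y \<in> hcarrier H"
  shows "hnorm H (x - y) = hnorm H (y - x)"
proof -
  interpret M: Metric_space "hcarrier H" "hdist H" by (rule Metric_space_hdist)
  show ?thesis using M.commute[of x y] assms by (simp add: hdist_def)
qed

lemma hnorm_diff_triangle:
  assumes "x \<in> hcarrier H" "y \<in> hcarrier H" "z \<in> hcarrier H"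
  shows "hnorm H (x - z) \<le> hnorm H (x - y) + hnorm H (y - z)"
  using hnorm_triangle[OF hcarrier_closed(3)[OF assms(1,2)] hcarrier_closed(3)[OF assms(2,3)]] by simp

lemma hnorm_diff_ge:
  assumes "x \<in> hcarrier H" "y \<in> hcarrier H"
  shows "hnorm H x \<le> hnorm H (x - y) + hnorm H y"
  using hnorm_triangle[OF hcarrier_closed(3)[OF assms] assms(2)] by simp

definition cauchy :: "(nat \<Rightarrow> 'h) \<Rightarrow> bool" where
  "cauchy s \<longleftrightarrow> (\<forall>n. s n \<in> hcarrier H) \<and> (\<forall>e>0. \<exists>N. \<forall>m\<ge>N. \<forall>n\<ge>N. hnorm H (s m - s n) < e)"

text \<open>The distance of the metric space carries a case distinction on membership in the carrier; the
lemmas below replace it by the norm of a difference.\<close>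
lemma MCauchy_iff_cauchy: "Metric_space.MCauchy (hcarrier H) (hdist H) s \<longleftrightarrow> cauchy s"
proof -
  interpret M: Metric_space "hcarrier H" "hdist H" by (rule Metric_space_hdist)
  have "hdist H (s m) (s n) = hnorm H (s m - s n)" if "range s \<subseteq> hcarrier H" for m n
    using that by (auto simp: hdist_def)
  then show ?thesis
    unfolding M.MCauchy_def cauchy_def by (cases "range s \<subseteq> hcarrier H") (simp_all add: image_subset_iff, blast)
qed

lemma limitin_iff_hnorm:
  assumes "\<And>n. s n \<in> hcarrier H"
  shows "limitin (Metric_space.mtopology (hcarrier H) (hdist H)) s l sequentially
    \<longleftrightarrow> l \<in> hcarrier H \<and> (\<lambda>n. hnorm H (s n - l)) \<longlonglongrightarrow> 0"
proof -
  interpret M: Metric_space "hcarrier H" "hdist H" by (rule Metric_space_hdist)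
  show ?thesis
  proof (cases "l \<in> hcarrier H")
    case True
    then have "hdist H (s n) l = hnorm H (s n - l)" for n using assms by (simp add: hdist_def)
    moreover have "0 \<le> hnorm H (s n - l)" for n
      by (intro hnorm_nonneg hcarrier_closed(3) assms True)
    ultimately show ?thesis using True assms
      unfolding M.limit_metric_sequentially LIMSEQ_def by simp
  qed (simp add: M.limit_metric_sequentially)
qed

lemma mcomplete_iff_cauchy:
  "Metric_space.mcomplete (hcarrier H) (hdist H) \<longleftrightarrow>
    (\<forall>s. cauchy s \<longrightarrow> (\<exists>l\<in>hcarrier H. (\<lambda>n. hnorm H (s n - l)) \<longlonglongrightarrow> 0))"
proof -
  interpret M: Metric_space "hcarrier H" "hdist H" by (rule Metric_space_hdist)
  have "(\<exists>l. limitin M.mtopology s l sequentially)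
      \<longleftrightarrow> (\<exists>l\<in>hcarrier H. (\<lambda>n. hnorm H (s n - l)) \<longlonglongrightarrow> 0)" if "cauchy s" for s
    using that by (subst limitin_iff_hnorm) (auto simp: cauchy_def)
  then show ?thesis unfolding M.mcomplete_def MCauchy_iff_cauchy by blast
qed

lemma cauchyD: "cauchy s \<Longrightarrow> s n \<in> hcarrier H"
  "cauchy s \<Longrightarrow> 0 < e \<Longrightarrow> \<exists>N. \<forall>m\<ge>N. \<forall>n\<ge>N. hnorm H (s m - s n) < e"
  unfolding cauchy_def by blast+

lemma cauchy_const: "x \<in> hcarrier H \<Longrightarrow> cauchy (\<lambda>_. x)"
  using hnorm_eq_0[OF hcarrier_closed(1)] by (simp add: cauchy_def)

lemma cauchy_add:
  assumes "cauchy s" "cauchy t"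
  shows "cauchy (\<lambda>n. s n + t n)"
  unfolding cauchy_def
proof (intro conjI allI impI)
  show "s n + t n \<in> hcarrier H" for n using assms by (simp add: cauchyD hcarrier_closed(2))
  fix e :: real assume "e > 0"
  then have e: "e / 2 > 0" by simp
  obtain N M where N: "\<And>m n. m \<ge> N \<Longrightarrow> n \<ge> N \<Longrightarrow> hnorm H (s m - s n) < e / 2"
    and M: "\<And>m n. m \<ge> M \<Longrightarrow> n \<ge> M \<Longrightarrow> hnorm H (t m - t n) < e / 2"
    using cauchyD(2)[OF assms(1) e] cauchyD(2)[OF assms(2) e] by blast
  have "hnorm H (s m + t m - (s n + t n)) < e" if "m \<ge> max M N" "n \<ge> max M N" for m n
    using hnorm_triangle[of "s m - s n" "t m - t n"] N[of m n] M[of m n] that assms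
    by (simp add: cauchyD hcarrier_closed(3) add_diff_add)
  then show "\<exists>N. \<forall>m\<ge>N. \<forall>n\<ge>N. hnorm H (s m + t m - (s n + t n)) < e" by blast
qed

lemma cauchy_lipschitz_image:
  assumes s: "cauchy s" and t: "\<And>n. t n \<in> hcarrier H" and B: "0 \<le> B"
    and le: "\<And>m n. hnorm H (t m - t n) \<le> B * hnorm H (s m - s n)"
  shows "cauchy t"
  unfolding cauchy_def
proof (intro conjI allI impI t)
  fix e :: real assume e: "e > 0"
  then obtain N where N: "\<And>m n. m \<ge> N \<Longrightarrow> n \<ge> N \<Longrightarrow> hnorm H (s m - s n) < e / (B + 1)"
    using cauchyD(2)[OF s, of "e / (B + 1)"] B by auto
  have "hnorm H (t m - t n) < e" if mn: "m \<ge> N" "n \<ge> N" for m n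
  proof -
    have "B * hnorm H (s m - s n) \<le> B * (e / (B + 1))"
      using N[OF mn] B by (intro mult_left_mono) simp_all
    also have "\<dots> < e" using B e by (simp add: field_simps)
    finally show ?thesis using le[of m n] by simp
  qed
  then show "\<exists>N. \<forall>m\<ge>N. \<forall>n\<ge>N. hnorm H (t m - t n) < e" by blast
qed

lemma cauchy_scale:
  assumes s: "cauchy s"
  shows "cauchy (\<lambda>n. hscale H c (s n))"
proof (rule cauchy_lipschitz_image[OF s, of _ "cmod c"])
  show "hnorm H (hscale H c (s m) - hscale H c (s n)) \<le> cmod c * hnorm H (s m - s n)" for m n
    unfolding scale_right_diff_distrib[symmetric]
    by (simp add: hnorm_scale hcarrier_closed(3) cauchyD[OF s])
qed (simp_all add: cauchyD[OF s] hcarrier_closed(4))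

lemma cauchy_diff:
  assumes s: "cauchy s" and t: "cauchy t"
  shows "cauchy (\<lambda>n. s n - t n)"
  using cauchy_add[OF s cauchy_scale[OF t, of "-1"]] by (simp add: scale_minus_left)

lemma cauchy_bounded:
  assumes s: "cauchy s"
  obtains B where "0 < B" "\<And>n. hnorm H (s n) \<le> B"
proof -
  obtain N where N: "\<And>m n. m \<ge> N \<Longrightarrow> n \<ge> N \<Longrightarrow> hnorm H (s m - s n) < 1"
    using cauchyD(2)[OF s, of 1] by auto
  define B where "B = (\<Sum>n\<le>N. hnorm H (s n)) + 1"
  have le: "hnorm H (s n) \<le> (\<Sum>n\<le>N. hnorm H (s n))" if "n \<le> N" for n
    by (rule member_le_sum) (use that in \<open>auto simp: hnorm_nonneg cauchyD[OF s]\<close>)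
  have "hnorm H (s n) \<le> B" for n
  proof (cases "n \<le> N")
    case True
    then show ?thesis using le[of n] by (simp add: B_def)
  next
    case False
    then have "hnorm H (s n - s N) < 1" by (intro N) simp_all
    then show ?thesis
      using hnorm_diff_ge[OF cauchyD(1)[OF s] cauchyD(1)[OF s], of n N] le[OF order_refl]
      unfolding B_def by linarith
  qed
  moreover have "0 < B"
    unfolding B_def using cauchyD[OF s] by (intro add_nonneg_pos sum_nonneg hnorm_nonneg) auto
  ultimately show ?thesis using that by blast
qed

lemma hinner_diff_le:
  assumes "x \<in> hcarrier H" "y \<in> hcarrier H" "x' \<in> hcarrier H" "y' \<in> hcarrier H"
  shows "cmod (hinner H x y - hinner H x' y') \<le> hnorm H (x - x') * hnorm H y + hnorm H x' * hnorm H (y - y')"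
proof -
  have "hinner H x y - hinner H x' y' = hinner H (x - x') y + hinner H x' (y - y')"
    using assms by (simp add: hinner_diff_left hinner_diff_right hcarrier_closed(3))
  then show ?thesis
    using norm_triangle_ineq[of "hinner H (x - x') y" "hinner H x' (y - y')"]
      hinner_Cauchy_Schwarz[of "x - x'" y] hinner_Cauchy_Schwarz[of x' "y - y'"] assms
    by (simp add: hcarrier_closed(3))
qed

lemma cauchy_hinner_convergent:
  assumes s: "cauchy s" and t: "cauchy t"
  shows "convergent (\<lambda>n. hinner H (s n) (t n))"
proof -
  obtain A where A: "0 < A" "\<And>n. hnorm H (s n) \<le> A" by (rule cauchy_bounded[OF s]) blast
  obtain B where B: "0 < B" "\<And>n. hnorm H (t n) \<le> B" by (rule cauchy_bounded[OF t]) blast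
  have "Cauchy (\<lambda>n. hinner H (s n) (t n))"
  proof (rule metric_CauchyI)
    fix e :: real assume e: "e > 0"
    have e': "0 < e / (2 * B)" "0 < e / (2 * A)" using e A B by simp_all
    obtain N where N: "\<And>m n. m \<ge> N \<Longrightarrow> n \<ge> N \<Longrightarrow> hnorm H (s m - s n) < e / (2 * B)"
      using cauchyD(2)[OF s e'(1)] by blast
    obtain M where M: "\<And>m n. m \<ge> M \<Longrightarrow> n \<ge> M \<Longrightarrow> hnorm H (t m - t n) < e / (2 * A)"
      using cauchyD(2)[OF t e'(2)] by blast
    have "dist (hinner H (s m) (t m)) (hinner H (s n) (t n)) < e" if "m \<ge> max M N" "n \<ge> max M N" for m n
    proof -
      have "cmod (hinner H (s m) (t m) - hinner H (s n) (t n))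
          \<le> hnorm H (s m - s n) * hnorm H (t m) + hnorm H (s n) * hnorm H (t m - t n)"
        by (intro hinner_diff_le cauchyD(1)[OF s] cauchyD(1)[OF t])
      also have "\<dots> \<le> hnorm H (s m - s n) * B + A * hnorm H (t m - t n)"
        by (intro add_mono mult_left_mono mult_right_mono hnorm_nonneg hcarrier_closed(3) A B
            cauchyD(1)[OF s] cauchyD(1)[OF t])
      also have "\<dots> < e / (2 * B) * B + A * (e / (2 * A))"
        using that by (intro add_strict_mono mult_strict_right_mono mult_strict_left_mono N M A B) simp_all
      also have "\<dots> = e" using A B by simp
      finally show ?thesis by (simp add: dist_norm)
    qed
    then show "\<exists>M. \<forall>m\<ge>M. \<forall>n\<ge>M. dist (hinner H (s m) (t m)) (hinner H (s n) (t n)) < e" by blast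
  qed
  then show ?thesis by (rule Cauchy_convergent)
qed

lemma hinner_null_sequence:
  assumes s: "\<And>n. s n \<in> hcarrier H" "(\<lambda>n. hnorm H (s n)) \<longlonglongrightarrow> 0" and t: "cauchy t"
  shows "(\<lambda>n. hinner H (s n) (t n)) \<longlonglongrightarrow> 0" "(\<lambda>n. hinner H (t n) (s n)) \<longlonglongrightarrow> 0"
proof -
  obtain B where B: "0 < B" "\<And>n. hnorm H (t n) \<le> B" by (rule cauchy_bounded[OF t]) blast
  have lim: "(\<lambda>n. B * hnorm H (s n)) \<longlonglongrightarrow> 0"
    using tendsto_mult_right_zero[OF s(2)] .
  have "cmod (hinner H (s n) (t n)) \<le> B * hnorm H (s n)"
    and "cmod (hinner H (t n) (s n)) \<le> B * hnorm H (s n)" for n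
    using hinner_Cauchy_Schwarz[OF s(1) cauchyD(1)[OF t], of n n]
      hinner_Cauchy_Schwarz[OF cauchyD(1)[OF t] s(1), of n n]
      mult_right_mono[OF B(2)[of n] hnorm_nonneg[OF s(1)[of n]]]
    by (auto simp: mult.commute)
  then show "(\<lambda>n. hinner H (s n) (t n)) \<longlonglongrightarrow> 0" "(\<lambda>n. hinner H (t n) (s n)) \<longlonglongrightarrow> 0"
    by (auto intro: Lim_null_comparison[OF _ lim])
qed

end

section \<open>Reproducing kernel Hilbert spaces\<close>

definition function_scale :: "complex \<Rightarrow> ('x \<Rightarrow> complex) \<Rightarrow> 'x \<Rightarrow> complex" where
  "function_scale c f = (\<lambda>x. c * f x)"

lemma vector_space_function_scale: "vector_space function_scale"
  by unfold_locales (auto simp: function_scale_def fun_eq_iff algebra_simps)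

text \<open>The completion of the span of the functions \<open>k y\<close> is carried out inside the function space: its
elements are the pointwise limits of Cauchy sequences of the span.  The inner product is
antilinear in its second argument and \<open>\<langle>f, k x\<rangle> = f x\<close>.\<close>
locale reproducing_kernel =
  fixes k :: "'x \<Rightarrow> 'x \<Rightarrow> complex"
  assumes kernel: "positive_kernel k"
begin

definition kernel_comb :: "'x set \<Rightarrow> ('x \<Rightarrow> complex) \<Rightarrow> 'x \<Rightarrow> complex" where
  "kernel_comb F c = (\<lambda>x. \<Sum>y\<in>F. c y * k y x)"

definition pre_carrier :: "('x \<Rightarrow> complex) set" where
  "pre_carrier = {f. \<exists>F c. finite F \<and> f = kernel_comb F c}"

text \<open>The functions \<open>k y\<close> may be linearly dependent, so the coefficients of \<open>f\<close> are not unique; by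
\<open>kernel_comb_swap\<close> the value does not depend on them when \<open>g\<close> is in the span.\<close>
definition pre_inner :: "('x \<Rightarrow> complex) \<Rightarrow> ('x \<Rightarrow> complex) \<Rightarrow> complex" where
  "pre_inner f g = 
     (THE z. \<exists>F c. finite F \<and> f = kernel_comb F c \<and> z = (\<Sum>y\<in>F. c y * cnj (g y)))"

definition pre_space :: "('x \<Rightarrow> complex) hilbert_data" where
  "pre_space = \<lparr>hcarrier = pre_carrier, hscale = function_scale, hinner = pre_inner\<rparr>"

lemma pre_carrier_cases:
  assumes "f \<in> pre_carrier"
  obtains F c where "finite F" "f = kernel_comb F c"
  using assms unfolding pre_carrier_def by blast

lemma kernel_comb_swap:
  "(\<Sum>y\<in>F. c y * cnj (kernel_comb E d y)) = (\<Sum>z\<in>E. cnj (d z) * kernel_comb F c z)"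
proof -
  have "(\<Sum>y\<in>F. c y * cnj (kernel_comb E d y)) = (\<Sum>y\<in>F. \<Sum>z\<in>E. cnj (d z) * (c y * k y z))"
    by (simp add: kernel_comb_def sum_distrib_left positive_kernelD(1)[OF kernel, symmetric] mult_ac)
  also have "\<dots> = (\<Sum>z\<in>E. cnj (d z) * kernel_comb F c z)"
    by (subst sum.swap) (simp add: kernel_comb_def sum_distrib_left)
  finally show ?thesis .
qed

lemma kernel_comb_in_pre_carrier: "finite F \<Longrightarrow> kernel_comb F c \<in> pre_carrier"
  unfolding pre_carrier_def by blast

lemma pre_inner_right:
  assumes "f \<in> pre_carrier"
  shows "pre_inner f (kernel_comb E d) = (\<Sum>z\<in>E. cnj (d z) * f z)"
  unfolding pre_inner_def kernel_comb_swap
  using assms by (intro the_equality) (auto simp: pre_carrier_def)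

lemma pre_inner_left:
  assumes F: "finite F" and g: "g \<in> pre_carrier"
  shows "pre_inner (kernel_comb F c) g = (\<Sum>y\<in>F. c y * cnj (g y))"
proof -
  obtain E d where "g = kernel_comb E d" using g by (rule pre_carrier_cases)
  then show ?thesis
    using pre_inner_right[OF kernel_comb_in_pre_carrier[OF F]] by (simp only: kernel_comb_swap)
qed

lemma kernel_comb_extend:
  "finite E \<Longrightarrow> F \<subseteq> E \<Longrightarrow> kernel_comb F c = kernel_comb E (\<lambda>y. if y \<in> F then c y else 0)"
  unfolding kernel_comb_def by (intro ext sum.mono_neutral_cong_left) auto

lemma kernel_comb_add: "kernel_comb F c + kernel_comb F d = kernel_comb F (\<lambda>y. c y + d y)"
  by (simp add: kernel_comb_def fun_eq_iff sum.distrib distrib_right)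

lemma kernel_comb_scale: "function_scale a (kernel_comb F c) = kernel_comb F (\<lambda>y. a * c y)"
  by (simp add: kernel_comb_def function_scale_def sum_distrib_left mult.assoc)

lemma pre_carrier_add:
  assumes "f \<in> pre_carrier" "g \<in> pre_carrier"
  shows "f + g \<in> pre_carrier"
proof -
  obtain F c E d where "finite F" "f = kernel_comb F c" "finite E" "g = kernel_comb E d"
    using assms by (metis pre_carrier_cases)
  then have "f + g = kernel_comb (F \<union> E) (\<lambda>y. (if y \<in> F then c y else 0) + (if y \<in> E then d y else 0))"
    using kernel_comb_extend[of "F \<union> E" F c] kernel_comb_extend[of "F \<union> E" E d]
    by (simp add: kernel_comb_add)
  then show ?thesis using \<open>finite F\<close> \<open>finite E\<close> unfolding pre_carrier_def by blast
qed

lemma pre_inner_self: "finite F \<Longrightarrow>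
    pre_inner (kernel_comb F c) (kernel_comb F c) = (\<Sum>x\<in>F. \<Sum>y\<in>F. c x * cnj (c y) * k x y)"
proof -
  assume F: "finite F"
  have "pre_inner (kernel_comb F c) (kernel_comb F c) = (\<Sum>y\<in>F. \<Sum>x\<in>F. c x * cnj (c y) * k x y)"
    by (subst pre_inner_right) (rule kernel_comb_in_pre_carrier[OF F], simp add: kernel_comb_def sum_distrib_left mult_ac)
  then show ?thesis by (subst sum.swap)
qed

lemma pre_evaluation_bound:
  assumes "f \<in> pre_carrier"
  shows "(cmod (f x))\<^sup>2 \<le> Re (k x x) * Re (pre_inner f f)"
proof -
  obtain F c where F: "finite F" "f = kernel_comb F c"
    using assms by (rule pre_carrier_cases)
  show ?thesis
    using positive_kernel_Cauchy_Schwarz[OF kernel F(1), of c x]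
    unfolding F(2) pre_inner_self[OF F(1)] by (simp only: kernel_comb_def)
qed

sublocale pre: complex_inner_product_space pre_space
proof -
  interpret vector_space "hscale pre_space"
    unfolding pre_space_def by (simp add: vector_space_function_scale)
  have "kernel_comb {} (\<lambda>_. 0) = 0" by (simp add: kernel_comb_def fun_eq_iff)
  then have zero: "0 \<in> pre_carrier"
    using kernel_comb_in_pre_carrier[OF finite.emptyI] by metis
  have scale: "function_scale c f \<in> pre_carrier" if "f \<in> pre_carrier" for c f
    using that kernel_comb_in_pre_carrier by (metis kernel_comb_scale pre_carrier_cases)
  show "complex_inner_product_space pre_space"
  proof unfold_locales
    show "subspace (hcarrier pre_space)"
      unfolding subspace_def by (simp add: pre_space_def zero pre_carrier_add scale)
    fix f g h :: "'x \<Rightarrow> complex" and c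
    assume fg: "f \<in> hcarrier pre_space" "g \<in> hcarrier pre_space"
    show "hinner pre_space (f + g) h = hinner pre_space f h + hinner pre_space g h"
      if "h \<in> hcarrier pre_space"
      using fg that by (auto simp: pre_space_def pre_carrier_add pre_inner_right sum.distrib distrib_left elim!: pre_carrier_cases[of h])
    show "hinner pre_space (hscale pre_space c f) g = c * hinner pre_space f g"
    proof -
      obtain E d where g: "g = kernel_comb E d"
        using fg(2) by (auto simp: pre_space_def elim: pre_carrier_cases)
      show ?thesis
        using fg(1) scale[of f c] unfolding g
        by (simp add: pre_space_def pre_inner_right sum_distrib_left) (simp add: function_scale_def mult_ac)
    qed
    show "hinner pre_space g f = cnj (hinner pre_space f g)"
      using fg by (auto simp: pre_space_def pre_inner_right pre_inner_left elim!: pre_carrier_cases[of g])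
  next
    fix f :: "'x \<Rightarrow> complex"
    assume f: "f \<in> hcarrier pre_space" "f \<noteq> 0"
    then obtain x where x: "f x \<noteq> 0" by (auto simp: fun_eq_iff)
    have "0 < (cmod (f x))\<^sup>2" using x by simp
    also have "\<dots> \<le> Re (k x x) * Re (pre_inner f f)"
      using f pre_evaluation_bound by (simp add: pre_space_def)
    finally have "0 < Re (pre_inner f f)"
      using positive_kernel_diag(2)[OF kernel, of x] by (simp add: zero_less_mult_iff)
    then show "0 < Re (hinner pre_space f f)" by (simp add: pre_space_def)
  qed
qed

lemma kernel_section_pre: "k x \<in> hcarrier pre_space"
  unfolding pre_space_def pre_carrier_def
  by (auto intro!: exI[of _ "{x}"] exI[of _ "\<lambda>_. 1"] simp: kernel_comb_def fun_eq_iff)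

lemma pre_reproducing: "f \<in> hcarrier pre_space \<Longrightarrow> hinner pre_space f (k x) = f x"
  using pre_inner_right[of f "{x}" "\<lambda>_. 1"] by (simp add: pre_space_def kernel_comb_def)

lemma pre_cases:
  assumes "f \<in> hcarrier pre_space"
  obtains F c where "finite F" "f = (\<Sum>y\<in>F. hscale pre_space (c y) (k y))"
proof -
  obtain F c where F: "finite F" "f = kernel_comb F c"
    using assms by (auto simp: pre_space_def elim: pre_carrier_cases)
  have "(\<Sum>y\<in>F. hscale pre_space (c y) (k y)) = kernel_comb F c"
    by (rule ext, induction F rule: infinite_finite_induct)
      (simp_all add: pre_space_def function_scale_def kernel_comb_def)
  then show ?thesis using that F by metis
qed

definition represents :: "(nat \<Rightarrow> 'x \<Rightarrow> complex) \<Rightarrow> ('x \<Rightarrow> complex) \<Rightarrow> bool" where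
  "represents s f \<longleftrightarrow> pre.cauchy s \<and> (\<forall>x. (\<lambda>n. s n x) \<longlonglongrightarrow> f x)"

lemma representsD:
  assumes "represents s f"
  shows "pre.cauchy s" "s n \<in> hcarrier pre_space" "(\<lambda>n. s n x) \<longlonglongrightarrow> f x"
  using assms by (auto simp: represents_def pre.cauchyD)

lemma represents_const: "f \<in> hcarrier pre_space \<Longrightarrow> represents (\<lambda>_. f) f"
  by (simp add: represents_def pre.cauchy_const)

lemma represents_add: "represents s f \<Longrightarrow> represents t g \<Longrightarrow> represents (\<lambda>n. s n + t n) (f + g)"
  by (simp add: represents_def pre.cauchy_add tendsto_add)

lemma represents_diff: "represents s f \<Longrightarrow> represents t g \<Longrightarrow> represents (\<lambda>n. s n - t n) (f - g)"
  by (simp add: represents_def pre.cauchy_diff tendsto_diff)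

lemma represents_scale: "represents s f \<Longrightarrow> represents (\<lambda>n. hscale pre_space c (s n)) (function_scale c f)"
  unfolding represents_def
  by (auto simp: pre.cauchy_scale) (simp add: pre_space_def function_scale_def tendsto_mult_left)

text \<open>This is why pointwise limits describe the completion faithfully: a Cauchy sequence tending to \<open>0\<close>
pointwise tends to \<open>0\<close> weakly against the span, and in
\<open>\<parallel>s\<^sub>n\<parallel>\<^sup>2 = \<langle>s\<^sub>n, s\<^sub>n - s\<^sub>N\<rangle> + \<langle>s\<^sub>n, s\<^sub>N\<rangle>\<close> the first term is small by the Cauchy property and the second by weak
convergence.\<close>
lemma represents_zero_hnorm:
  assumes s: "represents s 0"
  shows "(\<lambda>n. hnorm pre_space (s n)) \<longlonglongrightarrow> 0"
proof -
  note c = representsD(1)[OF s] and car = representsD(2)[OF s]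
  have weak: "(\<lambda>n. hinner pre_space (s n) g) \<longlonglongrightarrow> 0" if g: "g \<in> hcarrier pre_space" for g
  proof -
    obtain F a where F: "finite F" "g = (\<Sum>y\<in>F. hscale pre_space (a y) (k y))"
      using g by (rule pre_cases)
    have "hinner pre_space (s n) g = (\<Sum>y\<in>F. cnj (a y) * s n y)" for n
      unfolding F(2)
      by (simp add: pre.hinner_sum_right pre.hinner_scale_right pre.hcarrier_closed(4) kernel_section_pre car pre_reproducing)
    moreover have "(\<lambda>n. \<Sum>y\<in>F. cnj (a y) * s n y) \<longlonglongrightarrow> (\<Sum>y\<in>F. cnj (a y) * 0)"
      using representsD(3)[OF s] by (intro tendsto_sum tendsto_mult_left) simp
    ultimately show ?thesis by simp
  qed
  obtain B where B: "0 < B" "\<And>n. hnorm pre_space (s n) \<le> B" by (rule pre.cauchy_bounded[OF c]) blast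
  have "(\<lambda>n. (hnorm pre_space (s n))\<^sup>2) \<longlonglongrightarrow> 0"
  proof (rule LIMSEQ_I)
    fix e :: real assume e: "e > 0"
    have e': "0 < e / (2 * B)" using e B by simp
    obtain N where N: "\<And>m n. m \<ge> N \<Longrightarrow> n \<ge> N \<Longrightarrow> hnorm pre_space (s m - s n) < e / (2 * B)"
      using pre.cauchyD(2)[OF c e'] by blast
    obtain M where M: "\<And>n. n \<ge> M \<Longrightarrow> cmod (hinner pre_space (s n) (s N)) < e / 2"
      using LIMSEQ_D[OF weak[OF car[of N]], of "e / 2"] e by auto
    have "norm ((hnorm pre_space (s n))\<^sup>2 - 0) < e" if n: "n \<ge> max M N" for n
    proof -
      have "(hnorm pre_space (s n))\<^sup>2 = cmod (hinner pre_space (s n) (s n))"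
        using pre.hinner_self_real[OF car[of n]] by (simp del: of_real_power)
      also have "hinner pre_space (s n) (s n) = hinner pre_space (s n) (s n - s N) + hinner pre_space (s n) (s N)"
        by (simp add: pre.hinner_diff_right car)
      also have "cmod \<dots> \<le> hnorm pre_space (s n) * hnorm pre_space (s n - s N) + cmod (hinner pre_space (s n) (s N))"
        by (intro order_trans[OF norm_triangle_ineq] add_right_mono pre.hinner_Cauchy_Schwarz car pre.hcarrier_closed(3))
      also have "\<dots> \<le> B * hnorm pre_space (s n - s N) + cmod (hinner pre_space (s n) (s N))"
        by (intro add_right_mono mult_right_mono B pre.hnorm_nonneg car pre.hcarrier_closed(3))
      also have "\<dots> < B * (e / (2 * B)) + e / 2"
        using n B by (intro add_strict_mono mult_strict_left_mono N M) auto
      also have "\<dots> = e" using B by simp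
      finally show ?thesis by simp
    qed
    then show "\<exists>no. \<forall>n\<ge>no. norm ((hnorm pre_space (s n))\<^sup>2 - 0) < e" by blast
  qed
  from tendsto_real_sqrt[OF this] show ?thesis
    by (simp add: pre.hnorm_nonneg car)
qed

definition rk_carrier :: "('x \<Rightarrow> complex) set" where
  "rk_carrier = {f. \<exists>s. represents s f}"

definition approximant :: "('x \<Rightarrow> complex) \<Rightarrow> nat \<Rightarrow> 'x \<Rightarrow> complex" where
  "approximant f = (SOME s. represents s f)"

definition rk_space :: "('x \<Rightarrow> complex) hilbert_data" where
  "rk_space = \<lparr>hcarrier = rk_carrier, hscale = function_scale,
     hinner = (\<lambda>f g. lim (\<lambda>n. hinner pre_space (approximant f n) (approximant g n)))\<rparr>"

lemma rk_carrierI: "represents s f \<Longrightarrow> f \<in> hcarrier rk_space"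
  by (auto simp: rk_space_def rk_carrier_def)

lemma represents_approximant: "f \<in> hcarrier rk_space \<Longrightarrow> represents (approximant f) f"
  using someI_ex[of "\<lambda>s. represents s f"] by (simp add: rk_space_def rk_carrier_def approximant_def)

lemma hscale_rk [simp]: "hscale rk_space = function_scale"
  by (simp add: rk_space_def)

lemma hscale_pre [simp]: "hscale pre_space = function_scale"
  by (simp add: pre_space_def)

lemma represents_hinner:
  assumes s: "represents s f" and t: "represents t g"
  shows "(\<lambda>n. hinner pre_space (s n) (t n)) \<longlonglongrightarrow> hinner rk_space f g"
proof -
  define s' t' where "s' = approximant f" and "t' = approximant g"
  have s': "represents s' f" and t': "represents t' g"
    unfolding s'_def t'_def using s t by (auto intro: represents_approximant rk_carrierI)
  note car = representsD(2)[OF s] representsD(2)[OF t] representsD(2)[OF s'] representsD(2)[OF t']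
  have "(\<lambda>n. hinner pre_space (s' n) (t' n)) \<longlonglongrightarrow> hinner rk_space f g"
    unfolding rk_space_def s'_def[symmetric] t'_def[symmetric] hilbert_data.simps
    using pre.cauchy_hinner_convergent[OF representsD(1)[OF s'] representsD(1)[OF t']]
    by (simp add: convergent_LIMSEQ_iff s'_def t'_def)
  moreover have "(\<lambda>n. hinner pre_space (s n - s' n) (t n)) \<longlonglongrightarrow> 0"
    using represents_diff[OF s s'] represents_zero_hnorm representsD(1)[OF t]
    by (intro pre.hinner_null_sequence) (simp_all add: car pre.hcarrier_closed(3))
  moreover have "(\<lambda>n. hinner pre_space (s' n) (t n - t' n)) \<longlonglongrightarrow> 0"
    using represents_diff[OF t t'] represents_zero_hnorm representsD(1)[OF s']
    by (intro pre.hinner_null_sequence) (simp_all add: car pre.hcarrier_closed(3))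
  ultimately have "(\<lambda>n. hinner pre_space (s' n) (t' n) + hinner pre_space (s n - s' n) (t n)
      + hinner pre_space (s' n) (t n - t' n)) \<longlonglongrightarrow> hinner rk_space f g + 0 + 0"
    by (intro tendsto_add)
  then show ?thesis by (simp add: pre.hinner_diff_left pre.hinner_diff_right car)
qed

lemma represents_hnorm:
  assumes "represents s f"
  shows "(\<lambda>n. hnorm pre_space (s n)) \<longlonglongrightarrow> hnorm rk_space f"
  unfolding hnorm_def by (intro tendsto_real_sqrt tendsto_Re represents_hinner assms)

lemma pre_subset_rk: "f \<in> hcarrier pre_space \<Longrightarrow> f \<in> hcarrier rk_space"
  by (rule rk_carrierI[OF represents_const])

lemma hinner_rk_pre:
  "f \<in> hcarrier pre_space \<Longrightarrow> g \<in> hcarrier pre_space \<Longrightarrow> hinner rk_space f g = hinner pre_space f g"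
  using LIMSEQ_unique[OF represents_hinner[OF represents_const represents_const]] by fastforce

lemma hnorm_rk_pre: "f \<in> hcarrier pre_space \<Longrightarrow> hnorm rk_space f = hnorm pre_space f"
  by (simp add: hnorm_def hinner_rk_pre)

lemma rk_evaluation_bound:
  assumes "f \<in> hcarrier rk_space"
  shows "(cmod (f x))\<^sup>2 \<le> Re (k x x) * Re (hinner rk_space f f)"
proof -
  note s = represents_approximant[OF assms]
  show ?thesis
  proof (rule LIMSEQ_le)
    show "(\<lambda>n. (cmod (approximant f n x))\<^sup>2) \<longlonglongrightarrow> (cmod (f x))\<^sup>2"
      by (intro tendsto_power tendsto_norm representsD[OF s])
    show "(\<lambda>n. Re (k x x) * Re (hinner pre_space (approximant f n) (approximant f n))) \<longlonglongrightarrow> Re (k x x) * Re (hinner rk_space f f)"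
      by (intro tendsto_mult_left tendsto_Re represents_hinner s)
    show "\<exists>N. \<forall>n\<ge>N. (cmod (approximant f n x))\<^sup>2 \<le> Re (k x x) * Re (hinner pre_space (approximant f n) (approximant f n))"
      using pre_evaluation_bound representsD(2)[OF s] by (auto simp: pre_space_def)
  qed
qed

sublocale rk: complex_inner_product_space rk_space
proof -
  interpret vector_space "hscale rk_space"
    by (simp add: vector_space_function_scale)
  show "complex_inner_product_space rk_space"
  proof unfold_locales
    show "subspace (hcarrier rk_space)"
      unfolding subspace_def
    proof (intro conjI ballI allI)
      show "0 \<in> hcarrier rk_space" by (rule pre_subset_rk[OF pre.hcarrier_closed(1)])
      fix f assume f: "f \<in> hcarrier rk_space"
      show "f + g \<in> hcarrier rk_space" if "g \<in> hcarrier rk_space" for g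
        by (rule rk_carrierI[OF represents_add[OF represents_approximant[OF f] represents_approximant[OF that]]])
      show "hscale rk_space c f \<in> hcarrier rk_space" for c
        using rk_carrierI[OF represents_scale[OF represents_approximant[OF f]]] by simp
    qed
    fix f g h :: "'x \<Rightarrow> complex" and c
    assume f: "f \<in> hcarrier rk_space" and g: "g \<in> hcarrier rk_space"
    note s = represents_approximant[OF f] and t = represents_approximant[OF g]
    show "hinner rk_space (f + g) h = hinner rk_space f h + hinner rk_space g h"
      if "h \<in> hcarrier rk_space"
    proof (rule LIMSEQ_unique)
      note u = represents_approximant[OF that]
      show "(\<lambda>n. hinner pre_space (approximant f n + approximant g n) (approximant h n)) \<longlonglongrightarrow> hinner rk_space (f + g) h"
        by (rule represents_hinner[OF represents_add[OF s t] u])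
      show "(\<lambda>n. hinner pre_space (approximant f n + approximant g n) (approximant h n)) \<longlonglongrightarrow> hinner rk_space f h + hinner rk_space g h"
        using tendsto_add[OF represents_hinner[OF s u] represents_hinner[OF t u]]
        by (simp add: pre.hinner_add_left representsD[OF s] representsD[OF t] representsD[OF u])
    qed
    show "hinner rk_space (hscale rk_space c f) g = c * hinner rk_space f g"
    proof (rule LIMSEQ_unique)
      show "(\<lambda>n. hinner pre_space (hscale pre_space c (approximant f n)) (approximant g n)) \<longlonglongrightarrow> hinner rk_space (hscale rk_space c f) g"
        using represents_hinner[OF represents_scale[OF s] t] by simp
      show "(\<lambda>n. hinner pre_space (hscale pre_space c (approximant f n)) (approximant g n)) \<longlonglongrightarrow> c * hinner rk_space f g"
        using tendsto_mult_left[OF represents_hinner[OF s t], of c] representsD(2)[OF s] representsD(2)[OF t]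
        by (simp only: pre.hinner_scale_left)
    qed
    show "hinner rk_space g f = cnj (hinner rk_space f g)"
    proof (rule LIMSEQ_unique[OF represents_hinner[OF t s]])
      have "hinner pre_space (approximant g n) (approximant f n) = cnj (hinner pre_space (approximant f n) (approximant g n))" for n
        by (intro pre.hinner_commute representsD[OF s] representsD[OF t])
      then show "(\<lambda>n. hinner pre_space (approximant g n) (approximant f n)) \<longlonglongrightarrow> cnj (hinner rk_space f g)"
        using tendsto_cnj[OF represents_hinner[OF s t]] by simp
    qed
  next
    fix f :: "'x \<Rightarrow> complex"
    assume f: "f \<in> hcarrier rk_space" "f \<noteq> 0"
    then obtain x where x: "f x \<noteq> 0" by (auto simp: fun_eq_iff)
    have "0 < (cmod (f x))\<^sup>2" using x by simp
    also have "\<dots> \<le> Re (k x x) * Re (hinner rk_space f f)"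
      by (rule rk_evaluation_bound[OF f(1)])
    finally show "0 < Re (hinner rk_space f f)"
      using positive_kernel_diag(2)[OF kernel, of x] by (simp add: zero_less_mult_iff)
  qed
qed

lemma kernel_section_rk: "k x \<in> hcarrier rk_space"
  by (rule pre_subset_rk[OF kernel_section_pre])

lemma reproducing:
  assumes "f \<in> hcarrier rk_space"
  shows "hinner rk_space f (k x) = f x"
proof (rule LIMSEQ_unique)
  note s = represents_approximant[OF assms]
  show "(\<lambda>n. hinner pre_space (approximant f n) (k x)) \<longlonglongrightarrow> hinner rk_space f (k x)"
    by (rule represents_hinner[OF s represents_const[OF kernel_section_pre]])
  show "(\<lambda>n. hinner pre_space (approximant f n) (k x)) \<longlonglongrightarrow> f x"
    using representsD(3)[OF s] by (simp add: pre_reproducing representsD(2)[OF s])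
qed

lemma represents_limit:
  assumes s: "represents s f"
  shows "(\<lambda>n. hnorm rk_space (f - s n)) \<longlonglongrightarrow> 0"
proof (rule LIMSEQ_I)
  fix e :: real assume e: "e > 0"
  then obtain N where N: "\<And>m n. m \<ge> N \<Longrightarrow> n \<ge> N \<Longrightarrow> hnorm pre_space (s m - s n) < e / 2"
    using pre.cauchyD(2)[OF representsD(1)[OF s], of "e / 2"] by auto
  have "hnorm rk_space (f - s n) < e" if n: "n \<ge> N" for n
  proof -
    have "(\<lambda>m. hnorm pre_space (s m - s n)) \<longlonglongrightarrow> hnorm rk_space (f - s n)"
      by (rule represents_hnorm[OF represents_diff[OF s represents_const[OF representsD(2)[OF s]]]])
    moreover have "\<exists>N. \<forall>m\<ge>N. hnorm pre_space (s m - s n) \<le> e / 2"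
      using N n by (auto intro: less_imp_le)
    ultimately have "hnorm rk_space (f - s n) \<le> e / 2" by (rule LIMSEQ_le_const2)
    then show ?thesis using e by simp
  qed
  moreover have "0 \<le> hnorm rk_space (f - s n)" for n
    by (intro rk.hnorm_nonneg rk.hcarrier_closed(3) rk_carrierI[OF s] pre_subset_rk representsD[OF s])
  ultimately show "\<exists>no. \<forall>n\<ge>no. norm (hnorm rk_space (f - s n) - 0) < e" by auto
qed

lemma pre_dense:
  assumes "f \<in> hcarrier rk_space" "0 < e"
  obtains g where "g \<in> hcarrier pre_space" "hnorm rk_space (f - g) < e"
proof -
  note s = represents_approximant[OF assms(1)]
  have "\<forall>\<^sub>F n in sequentially. hnorm rk_space (f - approximant f n) < e"
    using represents_limit[OF s] assms(2) by (rule order_tendstoD)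
  then obtain n where "hnorm rk_space (f - approximant f n) < e"
    using eventually_happens trivial_limit_sequentially by blast
  with that representsD(2)[OF s] show ?thesis by blast
qed

text \<open>Approximate a Cauchy sequence of the completion by one of the span; the pointwise limit of the
latter is the limit of both.\<close>
sublocale rk: complex_hilbert_space rk_space
proof
  show "Metric_space.mcomplete (hcarrier rk_space) (hdist rk_space)"
    unfolding rk.mcomplete_iff_cauchy
  proof (intro allI impI)
    fix \<sigma> assume \<sigma>: "rk.cauchy \<sigma>"
    note \<sigma>c = rk.cauchyD(1)[OF \<sigma>]
    have "\<exists>g. g \<in> hcarrier pre_space \<and> hnorm rk_space (\<sigma> n - g) < inverse (real (Suc n))" for n
      using pre_dense[OF \<sigma>c[of n], of "inverse (real (Suc n))"] by (metis inverse_positive_iff_positive of_nat_0_less_iff zero_less_Suc)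
    then obtain g where g: "\<And>n. g n \<in> hcarrier pre_space"
      and near: "\<And>n. hnorm rk_space (\<sigma> n - g n) < inverse (real (Suc n))" by metis
    note gc = pre_subset_rk[OF g]
    have near0: "(\<lambda>n. hnorm rk_space (\<sigma> n - g n)) \<longlonglongrightarrow> 0"
    proof (rule tendsto_sandwich[OF _ _ tendsto_const LIMSEQ_inverse_real_of_nat])
      show "\<forall>\<^sub>F n in sequentially. 0 \<le> hnorm rk_space (\<sigma> n - g n)"
        by (simp add: rk.hnorm_nonneg rk.hcarrier_closed(3) \<sigma>c gc)
      show "\<forall>\<^sub>F n in sequentially. hnorm rk_space (\<sigma> n - g n) \<le> inverse (real (Suc n))"
        using near by (simp add: less_imp_le del: of_nat_Suc)
    qed
    have cg: "pre.cauchy g"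
      unfolding pre.cauchy_def
    proof (intro conjI allI impI g)
      fix e :: real assume "e > 0"
      then have e: "e / 3 > 0" by simp
      obtain N where N: "\<And>m n. m \<ge> N \<Longrightarrow> n \<ge> N \<Longrightarrow> hnorm rk_space (\<sigma> m - \<sigma> n) < e / 3"
        using rk.cauchyD(2)[OF \<sigma> e] by blast
      obtain M where M: "\<And>n. n \<ge> M \<Longrightarrow> hnorm rk_space (\<sigma> n - g n) < e / 3"
        using order_tendstoD(2)[OF near0 e] by (auto simp: eventually_sequentially)
      have "hnorm pre_space (g m - g n) < e" if "m \<ge> max M N" "n \<ge> max M N" for m n
      proof -
        have "hnorm rk_space (g m - g n) \<le> hnorm rk_space (\<sigma> m - g m) + hnorm rk_space (\<sigma> m - g n)"
          using rk.hnorm_diff_triangle[OF gc \<sigma>c gc] rk.hnorm_minus_commute[OF gc \<sigma>c] by metis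
        moreover have "hnorm rk_space (\<sigma> m - g n) \<le> hnorm rk_space (\<sigma> m - \<sigma> n) + hnorm rk_space (\<sigma> n - g n)"
          by (rule rk.hnorm_diff_triangle[OF \<sigma>c \<sigma>c gc])
        moreover have "hnorm rk_space (\<sigma> m - \<sigma> n) < e / 3" "hnorm rk_space (\<sigma> m - g m) < e / 3"
          "hnorm rk_space (\<sigma> n - g n) < e / 3"
          using that by (intro N M; simp)+
        ultimately have "hnorm rk_space (g m - g n) < e" by linarith
        then show ?thesis by (simp add: hnorm_rk_pre pre.hcarrier_closed(3) g)
      qed
      then show "\<exists>N. \<forall>m\<ge>N. \<forall>n\<ge>N. hnorm pre_space (g m - g n) < e" by blast
    qed
    have "convergent (\<lambda>n. g n x)" for x
      using pre.cauchy_hinner_convergent[OF cg pre.cauchy_const[OF kernel_section_pre[of x]]]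
      by (simp add: pre_reproducing g)
    then have "represents g (\<lambda>x. lim (\<lambda>n. g n x))"
      using cg by (simp add: represents_def convergent_LIMSEQ_iff)
    then obtain f where f: "represents g f" by blast
    note fc = rk_carrierI[OF f]
    have "(\<lambda>n. hnorm rk_space (\<sigma> n - f)) \<longlonglongrightarrow> 0"
    proof (rule tendsto_sandwich[OF _ _ tendsto_const])
      show "(\<lambda>n. hnorm rk_space (\<sigma> n - g n) + hnorm rk_space (f - g n)) \<longlonglongrightarrow> 0"
        using tendsto_add[OF near0 represents_limit[OF f]] by simp
      show "\<forall>\<^sub>F n in sequentially. 0 \<le> hnorm rk_space (\<sigma> n - f)"
        by (simp add: rk.hnorm_nonneg rk.hcarrier_closed(3) \<sigma>c fc)
      show "\<forall>\<^sub>F n in sequentially. hnorm rk_space (\<sigma> n - f) \<le> hnorm rk_space (\<sigma> n - g n) + hnorm rk_space (f - g n)"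
        using rk.hnorm_diff_triangle[OF \<sigma>c gc fc] rk.hnorm_minus_commute[OF fc gc] by simp
    qed
    then show "\<exists>l\<in>hcarrier rk_space. (\<lambda>n. hnorm rk_space (\<sigma> n - l)) \<longlonglongrightarrow> 0"
      using fc by blast
  qed
qed

text \<open>A linear relation between the values of all kernel functions at three points holds for every
function of the space.  This is how identities between operators are verified when they do not already hold
for maps of the index set.\<close>
lemma kernel_linear_relation:
  assumes "\<And>y. k y x = a * k y x1 + b * k y x2" and f: "f \<in> hcarrier rk_space"
  shows "f x = a * f x1 + b * f x2"
proof -
  have "k x = function_scale (cnj a) (k x1) + function_scale (cnj b) (k x2)"
  proof
    fix y
    have "k x y = cnj (k y x)" by (rule positive_kernelD(1)[OF kernel])
    also have "\<dots> = cnj a * k x1 y + cnj b * k x2 y"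
      by (simp add: assms(1) positive_kernelD(1)[OF kernel, symmetric])
    finally show "k x y = (function_scale (cnj a) (k x1) + function_scale (cnj b) (k x2)) y"
      by (simp add: function_scale_def)
  qed
  then have "f x = hinner rk_space f (hscale rk_space (cnj a) (k x1) + hscale rk_space (cnj b) (k x2))"
    using reproducing[OF f, of x] by simp
  also have "\<dots> = a * f x1 + b * f x2"
    using f kernel_section_rk rk.hcarrier_closed(4)[OF kernel_section_rk]
    by (simp only: rk.hinner_add_right rk.hinner_scale_right reproducing complex_cnj_cnj)
  finally show ?thesis .
qed

section \<open>Composition operators\<close>

text \<open>The relation says \<open>k y \<circ> \<tau> = k (\<tau>' y)\<close>; with \<open>k y x = \<langle>v\<^sub>y, v\<^sub>x\<rangle>\<close>, the operator \<open>f \<mapsto> f \<circ> \<tau>\<close> maps \<open>v\<^sub>y\<close> to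
\<open>v\<^bsub>\<tau>' y\<^esub>\<close> and its adjoint maps \<open>v\<^sub>x\<close> to \<open>v\<^bsub>\<tau> x\<^esub>\<close>.\<close>
definition adjoint_maps :: "('x \<Rightarrow> 'x) \<Rightarrow> ('x \<Rightarrow> 'x) \<Rightarrow> bool" where
  "adjoint_maps \<tau> \<tau>' \<longleftrightarrow> (\<forall>x y. k y (\<tau> x) = k (\<tau>' y) x)"

lemma adjoint_maps_commute:
  assumes "adjoint_maps \<tau> \<tau>'"
  shows "adjoint_maps \<tau>' \<tau>"
  using assms positive_kernelD(1)[OF kernel] unfolding adjoint_maps_def by metis

lemma compose_comb:
  assumes "adjoint_maps \<tau> \<tau>'"
  shows "(\<Sum>y\<in>F. hscale pre_space (c y) (k y)) \<circ> \<tau> = (\<Sum>y\<in>F. hscale pre_space (c y) (k (\<tau>' y)))"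
  by (rule ext, induction F rule: infinite_finite_induct)
    (use assms in \<open>simp_all add: function_scale_def adjoint_maps_def\<close>)

lemma compose_pre:
  assumes "adjoint_maps \<tau> \<tau>'" "f \<in> hcarrier pre_space"
  shows "f \<circ> \<tau> \<in> hcarrier pre_space"
  using assms(2)
proof (rule pre_cases)
  fix F c assume "f = (\<Sum>y\<in>F. hscale pre_space (c y) (k y))"
  then show ?thesis
    using pre.hcarrier_closed(5)[OF pre.hcarrier_closed(4)[OF kernel_section_pre]]
    by (simp only: compose_comb[OF assms(1)])
qed

lemma compose_pre_adjoint:
  assumes adj: "adjoint_maps \<tau> \<tau>'" and f: "f \<in> hcarrier pre_space" and g: "g \<in> hcarrier pre_space"
  shows "hinner pre_space (f \<circ> \<tau>) g = hinner pre_space f (g \<circ> \<tau>')"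
proof -
  obtain F c where F: "finite F" "g = (\<Sum>y\<in>F. hscale pre_space (c y) (k y))"
    using g by (rule pre_cases)
  have "hinner pre_space (f \<circ> \<tau>) g = (\<Sum>y\<in>F. cnj (c y) * f (\<tau> y))"
    unfolding F(2) using compose_pre[OF adj f]
    by (simp add: pre.hinner_sum_right pre.hinner_scale_right pre.hcarrier_closed(4) kernel_section_pre pre_reproducing del: hscale_pre)
  also have "\<dots> = hinner pre_space f (g \<circ> \<tau>')"
    unfolding F(2) compose_comb[OF adjoint_maps_commute[OF adj]]
    using f by (simp add: pre.hinner_sum_right pre.hinner_scale_right pre.hcarrier_closed(4) kernel_section_pre pre_reproducing del: hscale_pre)
  finally show ?thesis .
qed

lemma represents_compose:
  assumes adj: "adjoint_maps \<tau> \<tau>'" and B: "0 \<le> B"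
    and bound: "\<And>f. f \<in> hcarrier pre_space \<Longrightarrow> hnorm pre_space (f \<circ> \<tau>) \<le> B * hnorm pre_space f"
    and s: "represents s f"
  shows "represents (\<lambda>n. s n \<circ> \<tau>) (f \<circ> \<tau>)"
  unfolding represents_def
proof
  show "pre.cauchy (\<lambda>n. s n \<circ> \<tau>)"
  proof (rule pre.cauchy_lipschitz_image[OF representsD(1)[OF s] _ B])
    have "(s m \<circ> \<tau>) - (s n \<circ> \<tau>) = (s m - s n) \<circ> \<tau>" for m n by (simp add: fun_eq_iff)
    then show "hnorm pre_space ((s m \<circ> \<tau>) - (s n \<circ> \<tau>)) \<le> B * hnorm pre_space (s m - s n)" for m n
      using bound[of "s m - s n"] by (simp add: pre.hcarrier_closed(3) representsD(2)[OF s])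
  qed (rule compose_pre[OF adj representsD(2)[OF s]])
  show "\<forall>x. (\<lambda>n. (s n \<circ> \<tau>) x) \<longlonglongrightarrow> (f \<circ> \<tau>) x"
    using representsD(3)[OF s] by simp
qed

lemma compose_bounded_operator:
  assumes adj: "adjoint_maps \<tau> \<tau>'" and B: "0 \<le> B"
    and bound: "\<And>f. f \<in> hcarrier pre_space \<Longrightarrow> hnorm pre_space (f \<circ> \<tau>) \<le> B * hnorm pre_space f"
  shows "bounded_operator rk_space (\<lambda>f. f \<circ> \<tau>)"
    and "f \<in> hcarrier rk_space \<Longrightarrow> hnorm rk_space (f \<circ> \<tau>) \<le> B * hnorm rk_space f"
proof -
  note rep = represents_compose[OF adj B bound represents_approximant]
  show le: "hnorm rk_space (f \<circ> \<tau>) \<le> B * hnorm rk_space f" if f: "f \<in> hcarrier rk_space" for f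
  proof (rule LIMSEQ_le)
    show "(\<lambda>n. hnorm pre_space (approximant f n \<circ> \<tau>)) \<longlonglongrightarrow> hnorm rk_space (f \<circ> \<tau>)"
      by (rule represents_hnorm[OF rep[OF _ f]])
    show "(\<lambda>n. B * hnorm pre_space (approximant f n)) \<longlonglongrightarrow> B * hnorm rk_space f"
      by (intro tendsto_mult_left represents_hnorm represents_approximant f)
    show "\<exists>N. \<forall>n\<ge>N. hnorm pre_space (approximant f n \<circ> \<tau>) \<le> B * hnorm pre_space (approximant f n)"
      using bound representsD(2)[OF represents_approximant[OF f]] by blast
  qed
  show "bounded_operator rk_space (\<lambda>f. f \<circ> \<tau>)"
    unfolding bounded_operator_def
  proof (intro conjI exI[of _ B] ballI allI)
    show "(\<lambda>f. f \<circ> \<tau>) \<in> hcarrier rk_space \<rightarrow> hcarrier rk_space"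
      using rk_carrierI[OF rep] by blast
  qed (simp_all add: le fun_eq_iff function_scale_def)
qed

lemma compose_is_adjoint:
  assumes adj: "adjoint_maps \<tau> \<tau>'" and B: "0 \<le> B"
    and bound: "\<And>f. f \<in> hcarrier pre_space \<Longrightarrow> hnorm pre_space (f \<circ> \<tau>) \<le> B * hnorm pre_space f"
    and bound': "\<And>f. f \<in> hcarrier pre_space \<Longrightarrow> hnorm pre_space (f \<circ> \<tau>') \<le> B * hnorm pre_space f"
  shows "is_adjoint rk_space (\<lambda>f. f \<circ> \<tau>) (\<lambda>f. f \<circ> \<tau>')"
  unfolding is_adjoint_def
proof (intro conjI ballI)
  note adj' = adjoint_maps_commute[OF adj]
  show "bounded_operator rk_space (\<lambda>f. f \<circ> \<tau>)" "bounded_operator rk_space (\<lambda>f. f \<circ> \<tau>')"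
    using compose_bounded_operator(1)[OF adj B bound] compose_bounded_operator(1)[OF adj' B bound'] by blast+
  fix f g assume f: "f \<in> hcarrier rk_space" and g: "g \<in> hcarrier rk_space"
  note s = represents_approximant[OF f] and t = represents_approximant[OF g]
  show "hinner rk_space (f \<circ> \<tau>) g = hinner rk_space f (g \<circ> \<tau>')"
  proof (rule LIMSEQ_unique)
    show "(\<lambda>n. hinner pre_space (approximant f n \<circ> \<tau>) (approximant g n)) \<longlonglongrightarrow> hinner rk_space (f \<circ> \<tau>) g"
      by (rule represents_hinner[OF represents_compose[OF adj B bound s] t])
    show "(\<lambda>n. hinner pre_space (approximant f n \<circ> \<tau>) (approximant g n)) \<longlonglongrightarrow> hinner rk_space f (g \<circ> \<tau>')"
      using represents_hinner[OF s represents_compose[OF adj' B bound' t]]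
      by (simp add: compose_pre_adjoint[OF adj] representsD(2)[OF s] representsD(2)[OF t])
  qed
qed

end

section \<open>The dilation\<close>

text \<open>The second alternative of the last assumption covers \<open>H = 0\<close>, where there is no vector state to
start from.\<close>
locale tensor_dilation = hilbert_contraction H T
  for H :: "'h::ab_group_add hilbert_data" and T :: "'h \<Rightarrow> 'h" +
  fixes \<alpha> :: "'a::unital_cstar_algebra \<Rightarrow> 'a" and \<phi> :: "'a \<Rightarrow> complex"
  assumes endomorphism: "unital_star_endomorphism \<alpha>"
    and positive: "positive_functional \<phi>"
    and invariant: "\<phi> (\<alpha> a) = \<phi> a"
    and normalized: "\<phi> 1 = 1 \<or> hcarrier H = {0}"
begin

lemmas \<alpha>_simps = unital_star_endomorphismD[OF endomorphism]
lemmas \<alpha>_pow_simps = unital_star_endomorphismD[OF unital_star_endomorphism_funpow[OF endomorphism]]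

lemma invariant_pow: "\<phi> ((\<alpha> ^^ n) a) = \<phi> a"
  by (induction n) (simp_all add: invariant)

text \<open>Replacing vectors off the carrier by \<open>0\<close> makes the kernel positive on the whole index type.\<close>
definition to_carrier :: "'h \<Rightarrow> 'h" where
  "to_carrier h = (if h \<in> hcarrier H then h else 0)"

lemma to_carrier_closed: "to_carrier h \<in> hcarrier H"
  by (simp add: to_carrier_def hcarrier_closed(1))

lemma to_carrier_id: "h \<in> hcarrier H \<Longrightarrow> to_carrier h = h"
  by (simp add: to_carrier_def)

text \<open>The inner product of \<open>W\<^sup>n \<rho>(a) e\<close> and \<open>W\<^sup>p \<rho>(b) e\<close>, moved to the level \<open>n + p\<close> by means of
\<open>W\<^sup>* \<rho>(a) e = \<rho>(\<alpha>(a)) W\<^sup>* e = \<rho>(\<alpha>(a)) e\<close>.\<close>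
definition state_form :: "nat \<times> 'a \<Rightarrow> nat \<times> 'a \<Rightarrow> complex" where
  "state_form = (\<lambda>(n, a) (p, b). \<phi> (star ((\<alpha> ^^ n) b) * (\<alpha> ^^ p) a))"

text \<open>Any level \<open>N\<close> above \<open>n\<close> and \<open>p\<close> serves as well as \<open>n + p\<close>: both sides agree after applying a power
of \<open>\<alpha>\<close> inside the invariant functional.  On finitely many indices a single level can be used, where
the form is visibly positive.\<close>
lemma state_form_common_level:
  assumes "n \<le> N" "p \<le> N"
  shows "state_form (n, a) (p, b) = \<phi> (star ((\<alpha> ^^ (N - p)) b) * (\<alpha> ^^ (N - n)) a)"
proof -
  have "\<phi> (star ((\<alpha> ^^ n) b) * (\<alpha> ^^ p) a) = \<phi> ((\<alpha> ^^ N) (star ((\<alpha> ^^ n) b) * (\<alpha> ^^ p) a))"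
    by (simp only: invariant_pow)
  also have "(\<alpha> ^^ N) (star ((\<alpha> ^^ n) b) * (\<alpha> ^^ p) a) = star ((\<alpha> ^^ (N + n)) b) * (\<alpha> ^^ (N + p)) a"
    by (simp only: \<alpha>_pow_simps funpow_add o_def)
  also have "\<dots> = star ((\<alpha> ^^ ((n + p) + (N - p))) b) * (\<alpha> ^^ ((n + p) + (N - n))) a"
    using assms by (simp add: add.commute)
  also have "\<dots> = (\<alpha> ^^ (n + p)) (star ((\<alpha> ^^ (N - p)) b) * (\<alpha> ^^ (N - n)) a)"
    unfolding funpow_add[of "n + p"] o_def \<alpha>_pow_simps ..
  also have "\<phi> \<dots> = \<phi> (star ((\<alpha> ^^ (N - p)) b) * (\<alpha> ^^ (N - n)) a)"
    by (rule invariant_pow)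
  finally show ?thesis by (simp add: state_form_def)
qed

lemma state_form_commute: "state_form y x = cnj (state_form x y)"
  by (cases x; cases y)
    (simp add: state_form_def positive_functionalD(3)[OF positive, symmetric] star_mult star_star)

lemma functional_sum: "\<phi> (sum f A) = (\<Sum>i\<in>A. \<phi> (f i))"
  using positive_functionalD(1)[OF positive] positive_functionalD(1)[OF positive, of 0 0]
  by (induction A rule: infinite_finite_induct) simp_all

lemma positive_kernel_state_form:
  fixes n :: "'x \<Rightarrow> nat" and a :: "'x \<Rightarrow> 'a"
  shows "positive_kernel (\<lambda>x y. state_form (n x, a x) (n y, a y))"
  unfolding positive_kernel_def
proof (intro conjI allI impI)
  show "state_form (n y, a y) (n x, a x) = cnj (state_form (n x, a x) (n y, a y))" for x y
    by (rule state_form_commute)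
  fix F :: "'x set" and c :: "'x \<Rightarrow> complex" assume F: "finite F"
  define N where "N = (\<Sum>x\<in>F. n x)"
  have N: "n x \<le> N" if "x \<in> F" for x
    unfolding N_def using F that by (intro member_le_sum) auto
  define b where "b x = scaleC (c x) ((\<alpha> ^^ (N - n x)) (a x))" for x
  have "c x * cnj (c y) * state_form (n x, a x) (n y, a y) = \<phi> (star (b y) * b x)" if "x \<in> F" "y \<in> F" for x y
    unfolding state_form_common_level[OF N[OF that(1)] N[OF that(2)]] b_def
    by (simp add: star_scaleC mult_scaleC_left mult_scaleC_right positive_functionalD(2)[OF positive])
  then have "(\<Sum>x\<in>F. \<Sum>y\<in>F. c x * cnj (c y) * state_form (n x, a x) (n y, a y))
      = (\<Sum>x\<in>F. \<Sum>y\<in>F. \<phi> (star (b y) * b x))" by simp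
  also have "\<dots> = \<phi> (star (sum b F) * sum b F)"
  proof -
    have "star (sum b F) = (\<Sum>y\<in>F. star (b y))"
      by (induction F rule: infinite_finite_induct) (simp_all add: star_add)
    then have "star (sum b F) * sum b F = (\<Sum>y\<in>F. \<Sum>x\<in>F. star (b y) * b x)"
      by (simp add: sum_product)
    then show ?thesis by (subst sum.swap) (simp add: functional_sum)
  qed
  finally show "0 \<le> Re (\<Sum>x\<in>F. \<Sum>y\<in>F. c x * cnj (c y) * state_form (n x, a x) (n y, a y))"
    using positive_functionalD(4)[OF positive, of "sum b F"] by simp
qed

text \<open>The exponents \<open>n\<close> and \<open>m\<close> are added in the first factor because \<open>W\<^sup>m e = e\<close>.\<close>
definition dilation_kernel :: "nat \<times> 'a \<times> int \<times> 'h \<Rightarrow> nat \<times> 'a \<times> int \<times> 'h \<Rightarrow> complex" where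
  "dilation_kernel = (\<lambda>(n, a, m, h) (p, b, q, g).
     nagy_form H T (int n + m, to_carrier h) (int p + q, to_carrier g) * state_form (n, a) (p, b))"

lemma dilation_kernel_eq: "dilation_kernel (n, a, m, h) (p, b, q, g) =
    nagy_form H T (int n + m, to_carrier h) (int p + q, to_carrier g) * \<phi> (star ((\<alpha> ^^ n) b) * (\<alpha> ^^ p) a)"
  by (simp add: dilation_kernel_def state_form_def)

lemma positive_kernel_dilation_kernel: "positive_kernel dilation_kernel"
proof -
  have "positive_kernel (\<lambda>x y. nagy_form H T (case x of (n, a, m, h) \<Rightarrow> int n + m, case x of (n, a, m, h) \<Rightarrow> to_carrier h)
          (case y of (n, a, m, h) \<Rightarrow> int n + m, case y of (n, a, m, h) \<Rightarrow> to_carrier h)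
        * state_form (fst x, fst (snd x)) (fst y, fst (snd y)))"
    by (intro positive_kernel_mult positive_kernel_state_form positive_kernel_nagy_form)
      (simp add: to_carrier_closed split: prod.split)
  also have "(\<lambda>x y. nagy_form H T (case x of (n, a, m, h) \<Rightarrow> int n + m, case x of (n, a, m, h) \<Rightarrow> to_carrier h)
          (case y of (n, a, m, h) \<Rightarrow> int n + m, case y of (n, a, m, h) \<Rightarrow> to_carrier h)
        * state_form (fst x, fst (snd x)) (fst y, fst (snd y))) = dilation_kernel"
    by (simp add: dilation_kernel_def fun_eq_iff)
  finally show ?thesis .
qed

sublocale reproducing_kernel dilation_kernel
  by unfold_locales (rule positive_kernel_dilation_kernel)

text \<open>On spanning vectors \<open>shift\<close> is \<open>U\<close> and \<open>unshift\<close> is \<open>U\<^sup>*\<close>, the latter by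
\<open>U\<^sup>* \<sigma>(a) U\<^sup>m = \<sigma>(\<alpha>(a)) U\<^bsup>m-1\<^esup>\<close> when \<open>n = 0\<close>; likewise \<open>act b\<close> is \<open>\<sigma>(b)\<close>, by
\<open>\<sigma>(b) U\<^sup>n = U\<^sup>n \<sigma>(\<alpha>\<^sup>n(b))\<close>.  The value at \<open>x\<close> of the image of \<open>f\<close> is \<open>\<langle>U f, v\<^sub>x\<rangle> = \<langle>f, U\<^sup>* v\<^sub>x\<rangle>\<close>, so \<open>U\<close> is
composition with \<open>unshift\<close>, and \<open>\<sigma> b\<close> is composition with \<open>act (star b)\<close>.\<close>
fun shift :: "nat \<times> 'a \<times> int \<times> 'h \<Rightarrow> nat \<times> 'a \<times> int \<times> 'h" where
  "shift (n, a, m, h) = (Suc n, a, m, h)"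

fun unshift :: "nat \<times> 'a \<times> int \<times> 'h \<Rightarrow> nat \<times> 'a \<times> int \<times> 'h" where
  "unshift (Suc n, a, m, h) = (n, a, m, h)"
| "unshift (0, a, m, h) = (0, \<alpha> a, m - 1, h)"

fun act :: "'a \<Rightarrow> nat \<times> 'a \<times> int \<times> 'h \<Rightarrow> nat \<times> 'a \<times> int \<times> 'h" where
  "act b (n, a, m, h) = (n, (\<alpha> ^^ n) b * a, m, h)"

definition \<sigma> :: "'a \<Rightarrow> ('a, 'h) dilation_vector \<Rightarrow> ('a, 'h) dilation_vector" where
  "\<sigma> b f = f \<circ> act (star b)"

definition U :: "('a, 'h) dilation_vector \<Rightarrow> ('a, 'h) dilation_vector" where
  "U f = f \<circ> unshift"

lemma nagy_form_shift_left: "nagy_form H T (int (Suc n) + m, g) (j, h) = nagy_form H T (int n + m, g) (j - 1, h)"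
  using nagy_form_shift[of "int n + m" 1 g "j - 1" h] by (simp add: add_ac)

lemma adjoint_shift: "adjoint_maps unshift shift"
  unfolding adjoint_maps_def
proof (intro allI)
  fix x y :: "nat \<times> 'a \<times> int \<times> 'h"
  obtain n a m h where y: "y = (n, a, m, h)" by (cases y)
  show "dilation_kernel y (unshift x) = dilation_kernel (shift y) x"
  proof (cases x rule: unshift.cases)
    case (1 p b q g)
    have "\<phi> (star ((\<alpha> ^^ Suc n) b) * (\<alpha> ^^ Suc p) a) = \<phi> (\<alpha> (star ((\<alpha> ^^ n) b) * (\<alpha> ^^ p) a))"
      by (simp add: \<alpha>_simps)
    then show ?thesis
      unfolding 1 y unshift.simps shift.simps dilation_kernel_eq nagy_form_shift_left
      by (simp only: invariant) (simp add: algebra_simps)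
  next
    case (2 b q g)
    show ?thesis
      unfolding 2 y unshift.simps shift.simps dilation_kernel_eq nagy_form_shift_left
      by (simp add: funpow_swap1)
  qed
qed

lemma adjoint_act: "adjoint_maps (act (star b)) (act b)"
  unfolding adjoint_maps_def
proof (intro allI)
  fix x y :: "nat \<times> 'a \<times> int \<times> 'h"
  obtain n a m h where y: "y = (n, a, m, h)" by (cases y)
  obtain p c q g where x: "x = (p, c, q, g)" by (cases x)
  have "star ((\<alpha> ^^ n) ((\<alpha> ^^ p) (star b) * c)) * (\<alpha> ^^ p) a
      = star ((\<alpha> ^^ n) c) * (\<alpha> ^^ (n + p)) b * (\<alpha> ^^ p) a"
    by (simp add: \<alpha>_pow_simps star_mult star_star funpow_add)
  also have "\<dots> = star ((\<alpha> ^^ n) c) * (\<alpha> ^^ p) ((\<alpha> ^^ n) b * a)"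
    by (simp add: \<alpha>_pow_simps mult.assoc add.commute[of n p] funpow_add)
  finally show "dilation_kernel y (act (star b) x) = dilation_kernel (act b y) x"
    by (simp add: x y dilation_kernel_eq)
qed

text \<open>The maps themselves are not inverse to each other: \<open>shift (unshift (0, a, m, h))\<close> is
\<open>(1, \<alpha> a, m - 1, h)\<close>.  By invariance of \<open>\<phi>\<close> it indexes the same vector.\<close>
lemma shift_unshift:
  assumes "f \<in> hcarrier rk_space"
  shows "f \<circ> shift \<circ> unshift = f"
proof
  fix x
  have "dilation_kernel y (shift (unshift x)) = dilation_kernel y x" for y
  proof (cases x rule: unshift.cases)
    case (2 b q g)
    obtain n a m h where y: "y = (n, a, m, h)" by (cases y)
    have "\<phi> (star ((\<alpha> ^^ n) (\<alpha> b)) * \<alpha> a) = \<phi> (\<alpha> (star ((\<alpha> ^^ n) b) * a))"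
      by (simp add: \<alpha>_simps funpow_swap1)
    then show ?thesis
      by (simp add: 2 y dilation_kernel_eq invariant)
  qed simp
  then show "(f \<circ> shift \<circ> unshift) x = f x"
    using kernel_linear_relation[of "shift (unshift x)" 1 x 0 x f] assms by simp
qed

lemma unshift_shift: "f \<circ> unshift \<circ> shift = f"
  by (auto simp: fun_eq_iff)

lemma hnorm_unshift:
  assumes f: "f \<in> hcarrier pre_space"
  shows "hnorm pre_space (f \<circ> unshift) = hnorm pre_space f"
  unfolding hnorm_def
  using compose_pre_adjoint[OF adjoint_shift f compose_pre[OF adjoint_shift f]] by (simp add: unshift_shift)

lemma hnorm_shift:
  assumes f: "f \<in> hcarrier pre_space"
  shows "hnorm pre_space (f \<circ> shift) = hnorm pre_space f"
proof -
  note adj = adjoint_maps_commute[OF adjoint_shift]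
  show ?thesis
    unfolding hnorm_def
    using compose_pre_adjoint[OF adj f compose_pre[OF adj f]] by (simp add: shift_unshift pre_subset_rk f)
qed

lemma \<sigma>_add:
  assumes f: "f \<in> hcarrier rk_space"
  shows "\<sigma> (a + b) f = \<sigma> a f + \<sigma> b f"
proof
  fix x :: "nat \<times> 'a \<times> int \<times> 'h"
  obtain n d m h where x: "x = (n, d, m, h)" by (cases x)
  have "dilation_kernel y (act (star (a + b)) x) = 1 * dilation_kernel y (act (star a) x) + 1 * dilation_kernel y (act (star b) x)" for y
    by (cases y) (simp add: x dilation_kernel_eq star_add \<alpha>_pow_simps distrib_right distrib_left positive_functionalD(1)[OF positive])
  from kernel_linear_relation[OF this f] show "\<sigma> (a + b) f x = (\<sigma> a f + \<sigma> b f) x"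
    by (simp add: \<sigma>_def)
qed

lemma \<sigma>_scale:
  assumes f: "f \<in> hcarrier rk_space"
  shows "\<sigma> (scaleC c a) f = function_scale c (\<sigma> a f)"
proof
  fix x :: "nat \<times> 'a \<times> int \<times> 'h"
  obtain n d m h where x: "x = (n, d, m, h)" by (cases x)
  have "dilation_kernel y (act (star (scaleC c a)) x) = c * dilation_kernel y (act (star a) x) + 0 * dilation_kernel y x" for y
    by (cases y) (simp add: x dilation_kernel_eq star_scaleC \<alpha>_pow_simps mult_scaleC_left mult_scaleC_right
        positive_functionalD(2)[OF positive])
  from kernel_linear_relation[OF this f] show "\<sigma> (scaleC c a) f x = function_scale c (\<sigma> a f) x"
    by (simp add: \<sigma>_def function_scale_def)
qed

lemma \<sigma>_mult: "\<sigma> (a * b) f = \<sigma> a (\<sigma> b f)"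
  by (auto simp: \<sigma>_def fun_eq_iff star_mult \<alpha>_pow_simps mult.assoc)

lemma \<sigma>_one: "\<sigma> 1 f = f"
  by (auto simp: \<sigma>_def fun_eq_iff \<alpha>_pow_simps)

lemma \<sigma>_pre_closed: "f \<in> hcarrier pre_space \<Longrightarrow> \<sigma> b f \<in> hcarrier pre_space"
  unfolding \<sigma>_def by (rule compose_pre[OF adjoint_act])

lemma \<sigma>_pre_adjoint:
  assumes "f \<in> hcarrier pre_space" "g \<in> hcarrier pre_space"
  shows "hinner pre_space (\<sigma> b f) g = hinner pre_space f (\<sigma> (star b) g)"
  using compose_pre_adjoint[OF adjoint_act assms] by (simp add: \<sigma>_def star_star)

text \<open>For \<open>M > \<parallel>b\<parallel>\<^sup>2\<close> write \<open>1 - b\<^sup>* b / M = c\<^sup>2\<close> with \<open>c\<close> self-adjoint; then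
\<open>\<parallel>f\<parallel>\<^sup>2 - \<parallel>\<sigma>(b) f\<parallel>\<^sup>2 / M = \<parallel>\<sigma>(c) f\<parallel>\<^sup>2 \<ge> 0\<close>.\<close>
lemma \<sigma>_pre_bound:
  assumes f: "f \<in> hcarrier pre_space"
  shows "hnorm pre_space (\<sigma> b f) \<le> (norm b + 1) * hnorm pre_space f"
proof -
  define M where "M = (norm b + 1)\<^sup>2"
  have "0 < norm b + 1" by (simp add: add_nonneg_pos)
  then have M: "0 < M" by (simp add: M_def)
  have "(norm b)\<^sup>2 < M" unfolding M_def by (intro power_strict_mono) auto
  then have "norm ((1 / M) *\<^sub>R (star b * b)) < 1"
    using M by (simp add: cstar_identity)
  moreover have "star ((1 / M) *\<^sub>R (star b * b)) = (1 / M) *\<^sub>R (star b * b)"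
    by (simp add: star_scaleR star_mult star_star)
  ultimately obtain c where c: "star c = c" "c * c = 1 - (1 / M) *\<^sub>R (star b * b)"
    using sqrt_one_minus by blast
  have rk: "f \<in> hcarrier rk_space" by (rule pre_subset_rk[OF f])
  have norm_\<sigma>: "Re (hinner pre_space (\<sigma> d f) (\<sigma> d f)) = Re (hinner pre_space f (\<sigma> (star d * d) f))" for d
    by (simp add: \<sigma>_pre_adjoint \<sigma>_pre_closed f \<sigma>_mult)
  have "f = \<sigma> (c * c + scaleC (of_real (1 / M)) (star b * b)) f"
    by (simp add: c(2) scaleR_scaleC[symmetric] \<sigma>_one del: of_real_divide)
  also have "\<dots> = \<sigma> (c * c) f + function_scale (of_real (1 / M)) (\<sigma> (star b * b) f)"
    by (simp only: \<sigma>_add[OF rk] \<sigma>_scale[OF rk])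
  finally have split: "f = \<sigma> (c * c) f + hscale pre_space (of_real (1 / M)) (\<sigma> (star b * b) f)"
    by (simp only: hscale_pre)
  have "hinner pre_space f f
      = hinner pre_space f (\<sigma> (c * c) f + hscale pre_space (of_real (1 / M)) (\<sigma> (star b * b) f))"
    using split by simp
  also have "\<dots> = hinner pre_space f (\<sigma> (c * c) f) + cnj (of_real (1 / M)) * hinner pre_space f (\<sigma> (star b * b) f)"
    by (simp only: pre.hinner_add_right pre.hinner_scale_right pre.hcarrier_closed(4) \<sigma>_pre_closed f)
  finally have "Re (hinner pre_space f f)
      = Re (hinner pre_space (\<sigma> c f) (\<sigma> c f)) + Re (hinner pre_space (\<sigma> b f) (\<sigma> b f)) / M"
    by (simp add: norm_\<sigma> c(1) del: of_real_divide)
  then have "Re (hinner pre_space (\<sigma> b f) (\<sigma> b f)) / M \<le> Re (hinner pre_space f f)"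
    using pre.hinner_ge_zero[OF \<sigma>_pre_closed[OF f], of c] by simp
  then have "Re (hinner pre_space (\<sigma> b f) (\<sigma> b f)) \<le> M * Re (hinner pre_space f f)"
    using M by (simp add: pos_divide_le_eq mult.commute)
  then have "hnorm pre_space (\<sigma> b f) \<le> sqrt (M * Re (hinner pre_space f f))"
    unfolding hnorm_def by (rule real_sqrt_le_mono)
  then show ?thesis
    by (simp add: hnorm_def real_sqrt_mult M_def)
qed

lemma representation_\<sigma>: "Defs.representation rk_space \<sigma>"
proof -
  have adj: "is_adjoint rk_space (\<sigma> b) (\<sigma> (star b))" for b
  proof -
    have "is_adjoint rk_space (\<lambda>f. f \<circ> act (star b)) (\<lambda>f. f \<circ> act b)"
      using \<sigma>_pre_bound[of _ b] \<sigma>_pre_bound[of _ "star b"]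
      by (intro compose_is_adjoint[OF adjoint_act, of "norm b + 1"]) (simp_all add: \<sigma>_def star_star norm_star)
    then show ?thesis by (simp add: \<sigma>_def[abs_def] star_star)
  qed
  then show ?thesis
    unfolding Defs.representation_def
    by (auto simp: \<sigma>_add \<sigma>_scale \<sigma>_mult \<sigma>_one is_adjoint_def)
qed

lemma is_adjoint_U: "is_adjoint rk_space U (\<lambda>f. f \<circ> shift)"
  unfolding U_def[abs_def]
  by (rule compose_is_adjoint[OF adjoint_shift, of 1]) (simp_all add: hnorm_shift hnorm_unshift)

lemma unitary_U: "unitary_operator rk_space U"
  unfolding unitary_operator_def
  using is_adjoint_U by (intro exI[of _ "\<lambda>f. f \<circ> shift"]) (simp add: U_def unshift_shift shift_unshift)

lemma contraction_U: "contraction rk_space U"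
  unfolding contraction_def
proof
  show "bounded_operator rk_space U" using is_adjoint_U by (simp add: is_adjoint_def)
  have le: "hnorm rk_space (U f) \<le> 1 * hnorm rk_space f" if "f \<in> hcarrier rk_space" for f
    unfolding U_def by (rule compose_bounded_operator(2)[OF adjoint_shift _ _ that]) (simp_all add: hnorm_unshift)
  have "hnorm rk_space 0 = 0" using rk.hnorm_eq_0[OF rk.hcarrier_closed(1)] by simp
  then have "0 \<in> {f \<in> hcarrier rk_space. hnorm rk_space f \<le> 1}"
    using rk.hcarrier_closed(1) by simp
  then show "op_norm rk_space U \<le> 1"
    unfolding op_norm_def using le by (intro cSUP_least) force+
qed

lemma covariant_U: "U (\<sigma> (\<alpha> a) f) = \<sigma> a (U f)"
proof
  fix x
  show "U (\<sigma> (\<alpha> a) f) x = \<sigma> a (U f) x"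
    by (cases x rule: unshift.cases) (simp_all add: U_def \<sigma>_def \<alpha>_simps funpow_swap1)
qed

lemma covariant_representation_U: "covariant_representation \<alpha> rk_space \<sigma> U"
  by (simp add: covariant_representation_def representation_\<sigma> contraction_U covariant_U)

text \<open>The function of the vector \<open>h \<otimes> e\<close>.\<close>
definition J :: "'h \<Rightarrow> ('a, 'h) dilation_vector" where
  "J h = dilation_kernel (0, 1, 0, h)"

lemma J_closed: "J h \<in> hcarrier rk_space"
  unfolding J_def by (rule kernel_section_rk)

lemma J_linear:
  assumes h: "h \<in> hcarrier H"
  shows "g \<in> hcarrier H \<Longrightarrow> J (h + g) = J h + J g" "J (hscale H c h) = function_scale c (J h)"
  using h
  by (auto simp: J_def fun_eq_iff dilation_kernel_eq to_carrier_id hcarrier_closed(2,4) nagy_form_add_left nagy_form_scale_left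
      to_carrier_closed distrib_right function_scale_def)

lemma hinner_J:
  assumes f: "f \<in> hcarrier rk_space"
  shows "hinner rk_space f (J h) = f (0, 1, 0, h)"
  unfolding J_def by (rule reproducing[OF f])

text \<open>The vector \<open>U\<^bsup>*n\<^esup> (g \<otimes> e)\<close> has index \<open>(0, 1, - n, g)\<close>.\<close>
lemma U_pow_J:
  assumes h: "h \<in> hcarrier H" and g: "g \<in> hcarrier H"
  shows "hinner rk_space ((U ^^ n) (J h)) (J g) = hinner H ((T ^^ n) h) g"
    and "(U ^^ n) (J h) \<in> hcarrier rk_space"
proof -
  show closed: "(U ^^ n) (J h) \<in> hcarrier rk_space" for n
  proof (induction n)
    case (Suc n)
    then show ?case
      using is_adjoint_U by (auto simp: is_adjoint_def bounded_operator_def)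
  qed (simp add: J_closed)
  have "(U ^^ n) f = f \<circ> (unshift ^^ n)" for f
  proof (induction n)
    case (Suc n)
    have "(U ^^ Suc n) f = U ((U ^^ n) f)" by simp
    also have "\<dots> = f \<circ> ((unshift ^^ n) \<circ> unshift)" by (simp only: Suc U_def comp_assoc)
    finally show ?case by (simp only: funpow_Suc_right)
  qed simp
  moreover have "(unshift ^^ n) (0, 1, m, g) = (0, 1, m - int n, g)" for m
    by (induction n) (simp_all add: \<alpha>_simps)
  ultimately have "((U ^^ n) (J h)) (0, 1, 0, g) = dilation_kernel (0, 1, 0, h) (0, 1, - int n, g)"
    by (simp add: J_def)
  also have "\<dots> = hinner H ((T ^^ n) h) g * \<phi> 1"
    by (simp add: dilation_kernel_eq to_carrier_id h g nagy_form_def)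
  also have "\<dots> = hinner H ((T ^^ n) h) g"
    using normalized pow_closed[OF h] g by (auto simp: hinner_zero_left)
  finally show "hinner rk_space ((U ^^ n) (J h)) (J g) = hinner H ((T ^^ n) h) g"
    by (simp add: hinner_J[OF closed])
qed

lemma J_isometric: "h \<in> hcarrier H \<Longrightarrow> g \<in> hcarrier H \<Longrightarrow> hinner rk_space (J h) (J g) = hinner H h g"
  using U_pow_J(1)[of h g 0] by simp

text \<open>Existence of the projection is \<open>U_pow_J\<close>; two candidates differ by an element of the image of \<open>J\<close>
that is orthogonal to itself.\<close>
lemma orth_proj_U_pow:
  assumes h: "h \<in> hcarrier H"
  shows "orth_proj rk_space (J ` hcarrier H) ((U ^^ n) (J h)) = J ((T ^^ n) h)"
  unfolding orth_proj_def
proof (rule the_equality)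
  let ?u = "(U ^^ n) (J h)"
  have Tc: "(T ^^ n) h \<in> hcarrier H" by (rule pow_closed[OF h])
  have orth: "hinner rk_space (?u - J ((T ^^ n) h)) m = 0" if "m \<in> J ` hcarrier H" for m
    using that h
    by (auto simp: rk.hinner_diff_left J_closed U_pow_J J_isometric Tc)
  then show "J ((T ^^ n) h) \<in> J ` hcarrier H \<and> (\<forall>m\<in>J ` hcarrier H. hinner rk_space (?u - J ((T ^^ n) h)) m = 0)"
    using Tc by blast
  fix p assume p: "p \<in> J ` hcarrier H \<and> (\<forall>m\<in>J ` hcarrier H. hinner rk_space (?u - p) m = 0)"
  then obtain g where g: "g \<in> hcarrier H" "p = J g" by blast
  define d where "d = g + hscale H (- 1) ((T ^^ n) h)"
  have dc: "d \<in> hcarrier H" unfolding d_def by (intro hcarrier_closed(2,4) g Tc)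
  have d: "J d = J g - J ((T ^^ n) h)"
    unfolding d_def using g Tc by (simp add: J_linear(1) hcarrier_closed(4) J_linear(2) del: scale_minus_left)
      (simp add: function_scale_def fun_eq_iff)
  have "hinner rk_space (J d) (J d) = hinner rk_space (?u - J ((T ^^ n) h)) (J d) - hinner rk_space (?u - p) (J d)"
    unfolding g(2) using U_pow_J(2)[OF h h] by (simp add: d rk.hinner_diff_left rk.hcarrier_closed(3) J_closed)
  also have "\<dots> = 0" using orth p dc by auto
  finally have "J d = 0" using rk.hinner_pos[OF J_closed, of d] by fastforce
  then show "p = J ((T ^^ n) h)" using d g(2) by simp
qed

text \<open>The image is closed because it is isometric to the complete space \<open>H\<close>.\<close>
lemma hilbert_embedding_J:
  assumes complete: "Metric_space.mcomplete (hcarrier H) (hdist H)"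
  shows "hilbert_embedding H rk_space J"
  unfolding hilbert_embedding_def
proof (intro conjI)
  interpret K: Metric_space "hcarrier rk_space" "hdist rk_space" by (rule rk.Metric_space_hdist)
  have diff: "J (h - g) = J h - J g" if "h \<in> hcarrier H" "g \<in> hcarrier H" for h g
    using J_linear(1)[of "h - g" g] that hcarrier_closed(3) by simp
  have iso: "hnorm rk_space (J h - J g) = hnorm H (h - g)" if "h \<in> hcarrier H" "g \<in> hcarrier H" for h g
    unfolding diff[OF that, symmetric] hnorm_def using J_isometric hcarrier_closed(3)[OF that] by simp
  show "closedin K.mtopology (J ` hcarrier H)"
    unfolding K.metric_closedin_iff_sequentially_closed
  proof (intro conjI allI impI)
    show "J ` hcarrier H \<subseteq> hcarrier rk_space" using J_closed by blast
    fix s l assume s: "range s \<subseteq> J ` hcarrier H \<and> limitin K.mtopology s l sequentially"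
    then have "\<forall>n. \<exists>h\<in>hcarrier H. s n = J h" by blast
    then obtain t where t: "\<And>n. t n \<in> hcarrier H" "\<And>n. s n = J (t n)" by metis
    have "K.MCauchy s"
      using s J_closed by (intro K.convergent_imp_MCauchy[of s l]) auto
    then have "cauchy t"
      unfolding rk.MCauchy_iff_cauchy rk.cauchy_def cauchy_def t(2) by (simp add: iso t(1))
    then obtain x where x: "x \<in> hcarrier H" "(\<lambda>n. hnorm H (t n - x)) \<longlonglongrightarrow> 0"
      using complete unfolding mcomplete_iff_cauchy by blast
    have "limitin K.mtopology s (J x) sequentially"
      by (subst rk.limitin_iff_hnorm) (simp_all add: t J_closed iso x)
    then have "l = J x"
      using s by (intro K.limitin_metric_unique[OF _ _ trivial_limit_sequentially]) blast+
    then show "l \<in> J ` hcarrier H" using x(1) by blast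
  qed
qed (auto simp: J_closed J_linear J_isometric)

end

lemma hilbert_contraction_of_contraction:
  assumes "complex_inner_product_space H" and T: "contraction H T"
  shows "hilbert_contraction H T"
proof -
  interpret complex_inner_product_space H by fact
  obtain B where T': "T \<in> hcarrier H \<rightarrow> hcarrier H"
    "\<And>x y. x \<in> hcarrier H \<Longrightarrow> y \<in> hcarrier H \<Longrightarrow> T (x + y) = T x + T y"
    "\<And>c x. x \<in> hcarrier H \<Longrightarrow> T (hscale H c x) = hscale H c (T x)"
    and B: "\<And>x. x \<in> hcarrier H \<Longrightarrow> hnorm H (T x) \<le> B * hnorm H x"
    using T unfolding contraction_def bounded_operator_def by blast
  have "hnorm H (T x) \<le> hnorm H x" if x: "x \<in> hcarrier H" for x
  proof (cases "hnorm H x = 0")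
    case True
    then show ?thesis using B[OF x] by simp
  next
    case False
    then have pos: "0 < hnorm H x" using hnorm_nonneg[OF x] by simp
    define u where "u = hscale H (of_real (1 / hnorm H x)) x"
    have u: "u \<in> hcarrier H" "hnorm H u = 1"
      using x pos by (simp_all add: u_def hcarrier_closed(4) hnorm_scale norm_divide)
    have "bdd_above ((\<lambda>x. hnorm H (T x)) ` {x \<in> hcarrier H. hnorm H x \<le> 1})"
    proof (rule bdd_aboveI2)
      fix y assume y: "y \<in> {x \<in> hcarrier H. hnorm H x \<le> 1}"
      then have "B * hnorm H y \<le> \<bar>B\<bar> * 1"
        using hnorm_nonneg[of y] by (intro mult_mono) auto
      with y show "hnorm H (T y) \<le> \<bar>B\<bar>" using B[of y] by simp
    qed
    then have "hnorm H (T u) \<le> op_norm H T"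
      unfolding op_norm_def using u by (intro cSUP_upper) simp_all
    then have "hnorm H (T u) \<le> 1" using T by (simp add: contraction_def)
    moreover have "hnorm H (T u) = hnorm H (T x) / hnorm H x"
      using hnorm_scale[OF funcset_mem[OF T'(1) x]] x pos by (simp add: u_def T'(3) norm_divide)
    ultimately show ?thesis using pos by simp
  qed
  then show ?thesis by unfold_locales (use T' in auto)
qed

lemma positive_functional_vector_state:
  assumes "complex_inner_product_space H" and \<pi>: "representation H \<pi>" and h: "h \<in> hcarrier H"
  shows "positive_functional (\<lambda>a. hinner H (\<pi> a h) h)"
proof -
  interpret complex_inner_product_space H by fact
  have closed: "\<pi> a x \<in> hcarrier H" if "x \<in> hcarrier H" for a x
    using \<pi> that unfolding Defs.representation_def bounded_operator_def by blast
  have adj: "hinner H (\<pi> a x) y = hinner H x (\<pi> (star a) y)" if "x \<in> hcarrier H" "y \<in> hcarrier H" for a x y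
    using \<pi> that unfolding Defs.representation_def is_adjoint_def by blast
  have lin: "\<pi> (a + b) h = \<pi> a h + \<pi> b h" "\<pi> (scaleC c a) h = hscale H c (\<pi> a h)" "\<pi> (a * b) h = \<pi> a (\<pi> b h)" for a b c
    using \<pi> h unfolding Defs.representation_def by blast+
  show ?thesis
    unfolding positive_functional_def
  proof (intro conjI allI)
    show "hinner H (\<pi> (star a) h) h = cnj (hinner H (\<pi> a h) h)" for a
      using hinner_commute[OF h closed[OF h]] adj[OF h h] by simp
    show "0 \<le> Re (hinner H (\<pi> (star a * a) h) h)" for a
      using hinner_ge_zero[OF closed[OF h]] by (simp add: lin adj closed h star_star)
  qed (simp_all add: lin hinner_add_left hinner_scale_left closed h)
qed

theorem corollary1p3:
  fixes \<alpha> :: "'a::unital_cstar_algebra \<Rightarrow> 'a"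
    and H :: "'h::ab_group_add hilbert_data"
    and \<pi> :: "'a \<Rightarrow> 'h \<Rightarrow> 'h"
    and T :: "'h \<Rightarrow> 'h"
  assumes "unital_star_endomorphism \<alpha>"
    and "inj \<alpha>"
    and "complex_hilbert_space H"
    and "covariant_representation \<alpha> H \<pi> T"
  shows "\<exists>(K :: ('a, 'h) dilation_vector hilbert_data) J \<sigma> U.
      complex_hilbert_space K \<and>
      hilbert_embedding H K J \<and>
      covariant_representation \<alpha> K \<sigma> U \<and>
      unitary_operator K U \<and>
      (\<forall>n. \<forall>h\<in>hcarrier H.
         J ((T ^^ n) h) = orth_proj K (J ` hcarrier H) ((U ^^ n) (J h)))"
proof -
  interpret complex_hilbert_space H by fact
  have \<pi>: "Defs.representation H \<pi>" and T: "contraction H T"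
    using assms(4) by (simp_all add: covariant_representation_def)
  interpret hilbert_contraction H T
    by (rule hilbert_contraction_of_contraction[OF complex_inner_product_space_axioms T])
  obtain h where h: "h \<in> hcarrier H" "hnorm H h = 1 \<or> hcarrier H = {0}"
  proof (cases "hcarrier H = {0}")
    case False
    then obtain x where x: "x \<in> hcarrier H" "x \<noteq> 0" using hcarrier_closed(1) by blast
    then have "0 < hnorm H x" using hnorm_eq_0 hnorm_nonneg[of x] by force
    then have "hnorm H (hscale H (of_real (1 / hnorm H x)) x) = 1"
      using x by (simp add: hnorm_scale norm_divide)
    then show ?thesis using that x hcarrier_closed(4) by blast
  qed (use that hcarrier_closed(1) in blast)
  obtain \<phi> where \<phi>: "positive_functional \<phi>" "\<And>a. \<phi> (\<alpha> a) = \<phi> a" "\<phi> 1 = hinner H (\<pi> 1 h) h"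
    using invariant_positive_functional[OF assms(1)
        positive_functional_vector_state[OF complex_inner_product_space_axioms \<pi> h(1)]] by blast
  have "\<pi> 1 h = h" using \<pi> h(1) by (simp add: Defs.representation_def)
  then have "\<phi> 1 = 1 \<or> hcarrier H = {0}"
    using h \<phi>(3) hinner_self_real[OF h(1)] by auto
  with assms(1) \<phi>(1,2) interpret tensor_dilation H T \<alpha> \<phi>
    by unfold_locales
  show ?thesis
    by (intro exI[of _ rk_space] exI[of _ J] exI[of _ \<sigma>] exI[of _ U] conjI ballI allI
        rk.complex_hilbert_space_axioms hilbert_embedding_J complete covariant_representation_U unitary_U
        orth_proj_U_pow[symmetric])
qed

end
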